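(* Let $d\ge2$, let $C\in\mathcal{C}_{ar}^d$ be a $d$-dimensional Archimedean copula and let $\gamma\in\mathcal{P}_{\mathcal{W}_d}$ be its corresponding Williamson measure. Then the following equivalences hold: (i) $\gamma$ is absolutely continuous if and only if $\mu_C^{abs}(\mathbb{I}^d)=1$. (ii) $\gamma$ is discrete if and only if $\mu_C^{dis}(\mathbb{I}^d)=1$. (iii) $\gamma$ is singular if and only if $\mu_C^{sing}(\mathbb{I}^d)=1$.
   Context: Notation: $\mathbb{I}=[0,1]$; conventions $\inf\emptyset=\infty$, $1/\infty=0$, $1/0=\infty$. Archimedean copulas and Williamson measures. A generator is a continuous non-increasing $\psi:[0,\infty)\to\mathbb{I}$ with $\psi(0)=1$, $\psi(\infty):=\lim_{z\to\infty}\psi(z)=0$, strictly decreasing on $[0,\inf\{x:\psi(x)=0\})$; its pseudo-inverse is $\varphi(y)=\inf\{z\in[0,\infty]:\psi(z)=y\}$, $y\in\mathbb{I}$. All generators are normalized by $\psi(1)=\frac12$. A $d$-dimensional Archimedean copula is a copula of the form $C(\mathbf{x})=\psi(\sum_{i=1}^d\varphi(x_i))$; this function is a copula iff $\psi$ is $d$-monotone, i.e. (with $\psi$ continuous on $[0,\infty)$) on $(0,\infty)$ $\psi$ is differentiable up to order $d-2$, $(-1)^k\psi^{(k)}\ge0$ for $k\le d-2$, and $(-1)^{d-2}\psi^{(d-2)}$ is non-increasing and convex. $\mathcal{C}_{ar}^d$ is the set of all $d$-dimensional Archimedean copulas. $\mathcal{P}_{\mathcal{W}_d}$ is the set of Borel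 probability measures $\gamma$ on $[0,\infty)$ with $\gamma(\{0\})=0$ and $\int_{[0,1]}(1-t)^{d-1}d\gamma(t)=\frac12$. The map $\gamma\mapsto\psi$, $\psi(z)=\int_{[0,\infty)}(1-tz)_+^{d-1}d\gamma(t)$, is a bijection from $\mathcal{P}_{\mathcal{W}_d}$ onto the normalized $d$-monotone generators, and $\psi\mapsto C$ is a bijection onto $\mathcal{C}_{ar}^d$; the $\gamma$ associated in this way with $C$ is its Williamson measure. Decompositions. A finite measure is called discrete if it is concentrated on a countable set, and singular if it has no point masses and is concentrated on a Lebesgue null set; absolute continuity is w.r.t. Lebesgue measure. $\mu_C$ is the probability measure on $\mathbb{I}^d$ with distribution function $C$; $C^{1:d-1}$ is the marginal copula of the first $d-1$ coordinates, with measure $\mu_{C^{1:d-1}}$ (always absolutely continuous for $C\in\mathcal{C}_{ar}^d$). Let $K_C:\mathbb{I}^{d-1}\times\mathcal{B}(\mathbb{I})\to\mathbb{I}$ be (a version of) the regular conditional distribution of the last coordinate given the first $d-1$ under $\mu_C$, and for each $\mathbf{x}$ let $K_C(\mathbf{x},\cdot)=K_C^{abs}(\mathbf{x},\cdot)+K_C^{dis}(\mathbf{x},\cdot)+K_C^{sing}(\mathbf{x},\cdot)$ be its decomposition into absolutely continuous, discrete and singular (i.e. having no point masses and concentrated on a Lebesgue null set) parts; these are sub-Markov kernels. For $\ast\in\{abs,dis,sing\}$ the measure $\mu_C^{\ast}$ on $\mathbb{I}^d$ is defined by $\mu_C^{\ast}(E\times F)=\int_E K_C^{\ast}(\mathbf{x},F)\,d\mu_{C^{1:d-1}}(\mathbf{x})$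 for Borel $E\subseteq\mathbb{I}^{d-1}$, $F\subseteq\mathbb{I}$. *)

theory Defs
  imports "HOL-Probability.Probability"
begin

section \<open>Archimedean generators\<close>

text \<open>Generators are functions on \<open>[0,\<infinity>)\<close>; values of \<open>\<psi>\<close> at negative arguments are irrelevant
  throughout. The normalisation \<open>\<psi> 1 = 1/2\<close> is part of the definition.\<close>

definition generator :: "(real \<Rightarrow> real) \<Rightarrow> bool" where
  "generator \<psi> \<longleftrightarrow>
     continuous_on {0..} \<psi> \<and> \<psi> ` {0..} \<subseteq> {0..1} \<and> antimono_on {0..} \<psi> \<and>
     \<psi> 0 = 1 \<and> (\<psi> \<longlongrightarrow> 0) at_top \<and>
     strict_antimono_on {x. 0 \<le> x \<and> ennreal x < Inf (ennreal ` {y. 0 \<le> y \<and> \<psi> y = 0})} \<psi> \<and>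
     \<psi> 1 = 1 / 2"

text \<open>The extension of \<open>\<psi>\<close> to \<open>[0,\<infinity>]\<close> by \<open>\<psi>(\<infinity>) = 0\<close>.\<close>

definition ext_gen :: "(real \<Rightarrow> real) \<Rightarrow> ennreal \<Rightarrow> real" where
  "ext_gen \<psi> z = (if z = \<infinity> then 0 else \<psi> (enn2real z))"

definition pseudo_inverse :: "(real \<Rightarrow> real) \<Rightarrow> real \<Rightarrow> ennreal" where
  "pseudo_inverse \<psi> y = Inf {z. ext_gen \<psi> z = y}"

definition archimedean :: "nat \<Rightarrow> (real \<Rightarrow> real) \<Rightarrow> (nat \<Rightarrow> real) \<Rightarrow> real" where
  "archimedean d \<psi> x = ext_gen \<psi> (\<Sum>i<d. pseudo_inverse \<psi> (x i))"

section \<open>Copulas\<close>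

abbreviation unit_interval :: "real measure" where
  "unit_interval \<equiv> restrict_space borel {0..1}"

text \<open>The cube \<open>[0,1]\<^sup>n\<close> with its Borel sets; points are extensional functions on \<open>{..<n}\<close>, so the
  last coordinate of a point of \<open>cube d\<close> has index \<open>d - 1\<close>.\<close>

abbreviation cube :: "nat \<Rightarrow> (nat \<Rightarrow> real) measure" where
  "cube n \<equiv> PiM {..<n} (\<lambda>_. unit_interval)"

definition has_cdf :: "nat \<Rightarrow> (nat \<Rightarrow> real) measure \<Rightarrow> ((nat \<Rightarrow> real) \<Rightarrow> real) \<Rightarrow> bool" where
  "has_cdf d M C \<longleftrightarrow> prob_space M \<and> sets M = sets (cube d) \<and>
     (\<forall>u\<in>space (cube d). measure M {x \<in> space (cube d). \<forall>i<d. x i \<le> u i} = C u)"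

definition copula :: "nat \<Rightarrow> ((nat \<Rightarrow> real) \<Rightarrow> real) \<Rightarrow> bool" where
  "copula d C \<longleftrightarrow> (\<exists>M. has_cdf d M C \<and>
     (\<forall>i<d. distr M borel (\<lambda>x. x i) = uniform_measure lborel {0..1}))"

definition copula_measure :: "nat \<Rightarrow> ((nat \<Rightarrow> real) \<Rightarrow> real) \<Rightarrow> (nat \<Rightarrow> real) measure" where
  "copula_measure d C = (THE M. has_cdf d M C)"

definition marginal_copula :: "nat \<Rightarrow> ((nat \<Rightarrow> real) \<Rightarrow> real) \<Rightarrow> (nat \<Rightarrow> real) \<Rightarrow> real" where
  "marginal_copula d C x = C (x(d - 1 := 1))"

abbreviation marginal_measure :: "nat \<Rightarrow> ((nat \<Rightarrow> real) \<Rightarrow> real) \<Rightarrow> (nat \<Rightarrow> real) measure" where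
  "marginal_measure d C \<equiv> copula_measure (d - 1) (marginal_copula d C)"

text \<open>A copula is a function on the cube, hence the agreement on \<open>space (cube d)\<close> only.\<close>

definition archimedean_copula :: "nat \<Rightarrow> ((nat \<Rightarrow> real) \<Rightarrow> real) \<Rightarrow> bool" where
  "archimedean_copula d C \<longleftrightarrow> copula d C \<and>
     (\<exists>\<psi>. generator \<psi> \<and> (\<forall>x\<in>space (cube d). C x = archimedean d \<psi> x))"

section \<open>Williamson measures\<close>

definition williamson_measures :: "nat \<Rightarrow> real measure set" where
  "williamson_measures d = {\<gamma>. prob_space \<gamma> \<and> sets \<gamma> = sets (restrict_space borel {0..}) \<and>
     measure \<gamma> {0} = 0 \<and> (LINT t:{0..1}|\<gamma>. (1 - t) ^ (d - 1)) = 1 / 2}"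

definition williamson_generator :: "nat \<Rightarrow> real measure \<Rightarrow> real \<Rightarrow> real" where
  "williamson_generator d \<gamma> z = (LINT t|\<gamma>. (max 0 (1 - t * z)) ^ (d - 1))"

definition is_williamson_measure_of ::
    "nat \<Rightarrow> real measure \<Rightarrow> ((nat \<Rightarrow> real) \<Rightarrow> real) \<Rightarrow> bool" where
  "is_williamson_measure_of d \<gamma> C \<longleftrightarrow> \<gamma> \<in> williamson_measures d \<and>
     (\<forall>x\<in>space (cube d). C x = archimedean d (williamson_generator d \<gamma>) x)"

section \<open>Decomposition of finite measures on Borel subsets of the line\<close>

text \<open>These notions are meant for finite measures \<open>M\<close> on the Borel sets of a Borel set
  \<open>space M\<close> of reals (below: \<open>[0,1]\<close> or \<open>[0,\<infinity>)\<close>).\<close>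

definition abs_cont :: "real measure \<Rightarrow> bool" where
  "abs_cont M \<longleftrightarrow> absolutely_continuous (restrict_space lborel (space M)) M"

definition discrete_measure :: "real measure \<Rightarrow> bool" where
  "discrete_measure M \<longleftrightarrow> (\<exists>A\<in>sets M. countable A \<and> emeasure M (space M - A) = 0)"

definition singular_measure :: "real measure \<Rightarrow> bool" where
  "singular_measure M \<longleftrightarrow> (\<forall>x\<in>space M. emeasure M {x} = 0) \<and>
     (\<exists>N\<in>sets M. N \<in> null_sets lborel \<and> emeasure M (space M - N) = 0)"

definition lebesgue_decomposition ::
    "real measure \<Rightarrow> real measure \<Rightarrow> real measure \<Rightarrow> real measure \<Rightarrow> bool" where
  "lebesgue_decomposition M A D S \<longleftrightarrow>
     sets A = sets M \<and> sets D = sets M \<and> sets S = sets M \<and>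
     abs_cont A \<and> discrete_measure D \<and> singular_measure S \<and>
     (\<forall>B\<in>sets M. emeasure M B = emeasure A B + emeasure D B + emeasure S B)"

definition abs_part :: "real measure \<Rightarrow> real measure" where
  "abs_part M = (THE A. \<exists>D S. lebesgue_decomposition M A D S)"

definition dis_part :: "real measure \<Rightarrow> real measure" where
  "dis_part M = (THE D. \<exists>A S. lebesgue_decomposition M A D S)"

definition sing_part :: "real measure \<Rightarrow> real measure" where
  "sing_part M = (THE S. \<exists>A D. lebesgue_decomposition M A D S)"

section \<open>Disintegration with respect to the last coordinate\<close>

text \<open>\<open>M(E \<times> F) = \<integral>\<^sub>E \<kappa>(x, F) d\<nu>(x)\<close> for Borel \<open>E \<subseteq> [0,1]\<^sup>d\<^sup>-\<^sup>1\<close> and \<open>F \<subseteq> [0,1]\<close>.\<close>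

definition disintegrates ::
    "nat \<Rightarrow> (nat \<Rightarrow> real) measure \<Rightarrow> (nat \<Rightarrow> real) measure \<Rightarrow> ((nat \<Rightarrow> real) \<Rightarrow> real measure) \<Rightarrow> bool"
  where
  "disintegrates d M \<nu> \<kappa> \<longleftrightarrow> sets M = sets (cube d) \<and>
     (\<forall>E\<in>sets (cube (d - 1)). \<forall>F\<in>sets unit_interval.
        emeasure M {x \<in> space (cube d). restrict x {..<d - 1} \<in> E \<and> x (d - 1) \<in> F}
          = (\<integral>\<^sup>+x\<in>E. emeasure (\<kappa> x) F \<partial>\<nu>))"

definition regular_conditional_distribution ::
    "nat \<Rightarrow> ((nat \<Rightarrow> real) \<Rightarrow> real) \<Rightarrow> ((nat \<Rightarrow> real) \<Rightarrow> real measure) \<Rightarrow> bool" where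
  "regular_conditional_distribution d C K \<longleftrightarrow>
     K \<in> measurable (cube (d - 1)) (prob_algebra unit_interval) \<and>
     disintegrates d (copula_measure d C) (marginal_measure d C) K"

text \<open>The measure \<open>\<mu>\<^sub>C\<^sup>*\<close> obtained from a version \<open>K\<close> of the conditional distribution by
  passing to one part (\<open>abs_part\<close>, \<open>dis_part\<close> or \<open>sing_part\<close>) of each \<open>K x\<close>.\<close>

definition copula_component ::
    "(real measure \<Rightarrow> real measure) \<Rightarrow> nat \<Rightarrow> ((nat \<Rightarrow> real) \<Rightarrow> real) \<Rightarrow>
     ((nat \<Rightarrow> real) \<Rightarrow> real measure) \<Rightarrow> (nat \<Rightarrow> real) measure" where
  "copula_component \<pi> d C K =
     (THE M. disintegrates d M (marginal_measure d C) (\<lambda>x. \<pi> (K x)))"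

end

theory Submission
  imports Defs "HOL-Real_Asymp.Real_Asymp"
begin

text \<open>
  Put \<open>n = d - 1\<close>. Let \<open>t\<close> have law \<open>\<gamma>\<close> and, given \<open>t\<close>, let \<open>x\<close> be uniform on the simplex
  \<open>{x \<ge> 0. t * \<Sum>x < 1}\<close>. By the volume formula for the simplex, \<open>C\<close> is the distribution function
  of \<open>(\<psi> x\<^sub>0, \<dots>, \<psi> x\<^sub>n\<^sub>-\<^sub>1, \<psi> (1 / t - \<Sum>x))\<close>. Hence, given the first \<open>n\<close> coordinates, the last one
  is the image under \<open>t \<mapsto> \<psi> (1 / t - s)\<close>, \<open>s = \<Sum>x\<close>, of a measure with density proportional to
  \<open>t\<^sup>n\<close> on \<open>t < 1 / s\<close> with respect to \<open>\<gamma>\<close>. Convexity makes this map and its inverse locally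
  Lipschitz, so it carries the absolutely continuous, discrete and singular parts of \<open>\<gamma>\<close> to those
  of the conditional distribution, and each component of \<open>\<mu>\<^sub>C\<close> has the mass of the corresponding
  part of \<open>\<gamma>\<close>.
\<close>

section \<open>Lebesgue decomposition on the line\<close>

text \<open>Two things shape the proof. First, the components are defined from an arbitrary version
  \<open>K\<close> by definite descriptions, so the explicit kernel has to be almost surely the only
  one and each description has to have exactly one solution. Second, the construction is carried out
  for any measure \<open>T\<close> below \<open>\<gamma>\<close>, while \<open>psi\<close>, the
  normalising constant and the law of the first coordinates stay those of \<open>\<gamma>\<close>.
  Taking for \<open>T\<close> the restrictions of \<open>\<gamma>\<close> to the three sets of a
  partition splits the copula measure additively over one common marginal. The delicate value of the
  last coordinate is \<open>0\<close>: \<open>psi\<close> may vanish on a half-line, where it is not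
  injective, and many \<open>t\<close> could collapse into an atom there. That happens only on a
  \<open>\<gamma>\<close>-null set of \<open>t\<close>. The sum \<open>s = 0\<close> is also
  excluded, because the normalising constant may be infinite there; it belongs to a Lebesgue null
  set of \<open>x\<close>.\<close>

lemma abs_cont_iff:
  assumes "\<Omega> \<in> sets borel" "sets M = sets (restrict_space borel \<Omega>)"
  shows "abs_cont M \<longleftrightarrow> (\<forall>B\<in>sets M. B \<in> null_sets lborel \<longrightarrow> emeasure M B = 0)"
proof -
  have sp: "space M = \<Omega>"
    using sets_eq_imp_space_eq[OF assms(2)] by (simp add: space_restrict_space)
  have 1: "B \<in> null_sets (restrict_space lborel (space M)) \<longleftrightarrow> B \<in> sets M \<and> B \<in> null_sets lborel" for B
    using assms(1) null_sets_restrict_space[of \<Omega> lborel B] null_setsD2[of B lborel]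
    by (auto simp: sp assms(2) sets_restrict_space_iff)
  show ?thesis
    unfolding abs_cont_def absolutely_continuous_def subset_eq Ball_def 1
    by (auto simp: null_sets_def)
qed

lemma countable_null_singletons:
  assumes "countable c" "c \<subseteq> space M" "\<And>x. x \<in> space M \<Longrightarrow> {x} \<in> sets M"
    and "\<And>x. x \<in> space M \<Longrightarrow> emeasure M {x} = 0"
  shows "c \<in> null_sets M"
proof -
  have "(\<Union>x\<in>c. {x}) \<in> null_sets M"
    by (rule null_sets_UN') (use assms in \<open>auto simp: null_sets_def\<close>)
  then show ?thesis by simp
qed

text \<open>One countable set \<open>C\<close> and one null set \<open>Z\<close> serve both
  decompositions. Each part is then a restriction of \<open>M\<close> itself: \<open>D\<close> to
  \<open>C\<close>, \<open>S\<close> to \<open>Z - C\<close>, \<open>A\<close> to the rest, which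
  leaves no freedom.\<close>

lemma lebesgue_decomposition_unique:
  assumes \<Omega>: "\<Omega> \<in> sets borel" and M: "sets M = sets (restrict_space borel \<Omega>)"
    and 1: "lebesgue_decomposition M A D S" and 2: "lebesgue_decomposition M A' D' S'"
  shows "A = A' \<and> D = D' \<and> S = S'"
proof -
  have sp: "space M = \<Omega>"
    using sets_eq_imp_space_eq[OF M] by (simp add: space_restrict_space)
  have sing: "{x} \<in> sets M" if "x \<in> space M" for x
    using that by (auto simp: M sp sets_restrict_space_iff \<Omega>)
  have borel: "B \<in> sets borel" if "B \<in> sets M" for B
    using that by (auto simp: M sets_restrict_space_iff \<Omega>)
  obtain c c' where c: "c \<in> sets M" "countable c" "emeasure D (space D - c) = 0"
    and c': "c' \<in> sets M" "countable c'" "emeasure D' (space D' - c') = 0"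
    using 1 2 unfolding lebesgue_decomposition_def discrete_measure_def by metis
  obtain N N' where N: "N \<in> sets M" "N \<in> null_sets lborel" "emeasure S (space S - N) = 0"
    and N': "N' \<in> sets M" "N' \<in> null_sets lborel" "emeasure S' (space S' - N') = 0"
    using 1 2 unfolding lebesgue_decomposition_def singular_measure_def by metis
  define C where "C = c \<union> c'"
  define Z where "Z = N \<union> N'"
  have C: "C \<in> sets M" "countable C" and Z: "Z \<in> sets M" "Z \<in> null_sets lborel"
    using c c' N N' by (auto simp: C_def Z_def)
  have Cnull: "C \<in> null_sets lborel"
    by (rule countable_imp_null_set_lborel[OF C(2)])
  have key: "emeasure D B = emeasure M (B \<inter> C) \<and> emeasure S B = emeasure M (B \<inter> Z - C) \<and>
      emeasure A B = emeasure M (B - Z - C)"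
    if L: "lebesgue_decomposition M A D S" and B: "B \<in> sets M"
      and D0: "emeasure D (space D - C) = 0" and S0: "emeasure S (space S - Z) = 0" for A D S B
  proof -
    from L have sets: "sets A = sets M" "sets D = sets M" "sets S = sets M"
      and ac: "abs_cont A" and ss: "singular_measure S"
      and sum: "\<And>B. B \<in> sets M \<Longrightarrow> emeasure M B = emeasure A B + emeasure D B + emeasure S B"
      unfolding lebesgue_decomposition_def by auto
    have spaces: "space A = space M" "space D = space M" "space S = space M"
      using sets by (auto dest: sets_eq_imp_space_eq)
    have nA: "C \<in> null_sets A" "Z \<in> null_sets A"
      using ac Cnull C Z abs_cont_iff[OF \<Omega>, of A] sets M by (auto simp: null_sets_def)
    have nD: "space M - C \<in> null_sets D" "space M - Z \<in> null_sets S"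
      using D0 S0 C Z sets spaces by (auto simp: null_sets_def)
    have nS: "C \<in> null_sets S"
      using ss C sing sets spaces sets.sets_into_space[OF C(1)]
      by (intro countable_null_singletons) (auto simp: singular_measure_def)
    have BM: "B \<subseteq> space M"
      using B by (rule sets.sets_into_space)
    have m: "B \<inter> C \<in> sets M" "B \<inter> Z - C \<in> sets M" "B - Z - C \<in> sets M"
      using B C Z by auto
    have nz: "emeasure X Y = 0" if "W \<in> null_sets X" "Y \<subseteq> W" "Y \<in> sets X" for W X and Y :: "real set"
      using that null_sets_subset by blast
    have "emeasure M (B \<inter> C) = emeasure D (B \<inter> C)"
      using sum[OF m(1)] nz[OF nA(1) _ , of "B \<inter> C"] nz[OF nS, of "B \<inter> C"] m sets by simp
    also have "\<dots> = emeasure D (B - (space M - C))"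
      using BM by (intro arg_cong[where f="emeasure D"]) auto
    also have "\<dots> = emeasure D B"
      using nD B sets by (intro emeasure_Diff_null_set) auto
    finally have eD: "emeasure M (B \<inter> C) = emeasure D B" .
    have "emeasure M (B \<inter> Z - C) = emeasure S (B \<inter> Z - C)"
      using sum[OF m(2)] nz[OF nA(2), of "B \<inter> Z - C"] nz[OF nD(1), of "B \<inter> Z - C"] m sets BM by auto
    also have "\<dots> = emeasure S (B - (C \<union> (space M - Z)))"
      using BM by (intro arg_cong[where f="emeasure S"]) auto
    also have "\<dots> = emeasure S B"
      using nD nS B sets by (intro emeasure_Diff_null_set) auto
    finally have eS: "emeasure M (B \<inter> Z - C) = emeasure S B" .
    have "emeasure M (B - Z - C) = emeasure A (B - Z - C)"
      using sum[OF m(3)] nz[OF nD(2), of "B - Z - C"] nz[OF nD(1), of "B - Z - C"] m sets BM by auto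
    also have "\<dots> = emeasure A (B - (C \<union> Z))"
      by (intro arg_cong[where f="emeasure A"]) auto
    also have "\<dots> = emeasure A B"
      using nA B sets by (intro emeasure_Diff_null_set) auto
    finally show ?thesis using eD eS by simp
  qed
  have sub: "emeasure X (space X - W') = 0"
    if "emeasure X (space X - W) = 0" "W \<in> sets M" "W' \<in> sets M" "W \<subseteq> W'" "sets X = sets M" for X W W'
    using that emeasure_mono[of "space X - W'" "space X - W" X] by (auto simp: Diff_mono)
  have sets: "sets A = sets M" "sets D = sets M" "sets S = sets M"
    "sets A' = sets M" "sets D' = sets M" "sets S' = sets M"
    using 1 2 unfolding lebesgue_decomposition_def by auto
  have e: "emeasure D (space D - C) = 0" "emeasure S (space S - Z) = 0"
    "emeasure D' (space D' - C) = 0" "emeasure S' (space S' - Z) = 0"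
    using sub[OF c(3,1) C(1)] sub[OF c'(3,1) C(1)] sub[OF N(3,1) Z(1)] sub[OF N'(3,1) Z(1)]
    by (simp_all add: sets C_def Z_def)
  have k1: "\<And>B. B \<in> sets M \<Longrightarrow> emeasure D B = emeasure M (B \<inter> C) \<and> emeasure S B = emeasure M (B \<inter> Z - C) \<and>
      emeasure A B = emeasure M (B - Z - C)"
    by (rule key[OF 1 _ e(1,2)])
  have k2: "\<And>B. B \<in> sets M \<Longrightarrow> emeasure D' B = emeasure M (B \<inter> C) \<and> emeasure S' B = emeasure M (B \<inter> Z - C) \<and>
      emeasure A' B = emeasure M (B - Z - C)"
    by (rule key[OF 2 _ e(3,4)])
  show ?thesis
    by (intro conjI measure_eqI) (use sets k1 k2 in auto)
qed

lemma parts_eq: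
  assumes "\<Omega> \<in> sets borel" "sets M = sets (restrict_space borel \<Omega>)"
    and "lebesgue_decomposition M A D S"
  shows "abs_part M = A" "dis_part M = D" "sing_part M = S"
  unfolding abs_part_def dis_part_def sing_part_def
  by (rule the_equality; use assms lebesgue_decomposition_unique[OF assms(1,2)] in blast)+

text \<open>Exhaustion: choose null sets whose masses approach the supremum over all null sets;
  their union attains it. A null set with mass outside the union would exceed the supremum, and
  finiteness of \<open>M\<close> allows the cancellation that shows this.\<close>

lemma exists_maximal_null_set:
  assumes "finite_measure M" "\<Omega> \<in> sets borel" "sets M = sets (restrict_space borel \<Omega>)"
  obtains N where "N \<in> sets M" "N \<in> null_sets lborel"
    "\<And>B. B \<in> sets M \<Longrightarrow> B \<in> null_sets lborel \<Longrightarrow> emeasure M (B - N) = 0"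
proof -
  interpret finite_measure M by fact
  define F where "F = {N \<in> sets M. N \<in> null_sets lborel}"
  have "emeasure M ` F \<noteq> {}"
    by (auto simp: F_def intro!: exI[of _ "{}"])
  from ennreal_Sup_countable_SUP[OF this] obtain f :: "nat \<Rightarrow> ennreal"
    where f: "range f \<subseteq> emeasure M ` F" "(SUP N\<in>F. emeasure M N) = (SUP i. f i)"
    by blast
  from f(1) have "\<forall>i. \<exists>N\<in>F. f i = emeasure M N" by blast
  then obtain N where N: "\<And>i. N i \<in> F" "\<And>i. f i = emeasure M (N i)" by metis
  have UF: "(\<Union>i. N i) \<in> F"
    using N(1) by (auto simp: F_def)
  have le: "(SUP N\<in>F. emeasure M N) \<le> emeasure M (\<Union>i. N i)"
    unfolding f(2) N(2) using UF by (intro SUP_least emeasure_mono) (auto simp: F_def)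
  show ?thesis
  proof
    show "(\<Union>i. N i) \<in> sets M" "(\<Union>i. N i) \<in> null_sets lborel" using UF by (auto simp: F_def)
    fix B assume B: "B \<in> sets M" "B \<in> null_sets lborel"
    let ?U = "\<Union>i. N i"
    have m: "?U \<in> sets M" using UF by (auto simp: F_def)
    have "emeasure M (B - ?U) + emeasure M ?U = emeasure M (B - ?U \<union> ?U)"
      using B m by (intro plus_emeasure) auto
    also have "B - ?U \<union> ?U \<in> F" using B UF by (auto simp: F_def)
    then have "emeasure M (B - ?U \<union> ?U) \<le> (SUP N\<in>F. emeasure M N)"
      by (rule SUP_upper)
    also note le
    finally have "emeasure M (B - ?U) + emeasure M ?U \<le> 0 + emeasure M ?U" by simp
    then show "emeasure M (B - ?U) = 0"
      using ennreal_add_left_cancel_le[of "emeasure M ?U" "emeasure M (B - ?U)" 0]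
      by (simp add: add.commute)
  qed
qed

text \<open>Writing the partition as a sum of indicators reduces the splitting to distributivity. It
  serves both for \<open>\<gamma>\<close> and for the kernels built from its parts.\<close>

lemma nn_integral_indicator_partition:
  assumes PQR: "P \<in> sets M" "Q \<in> sets M" "R \<in> sets M"
    and part: "\<And>x. x \<in> space M \<Longrightarrow> indicator P x + indicator Q x + indicator R x = (1 :: ennreal)"
    and f: "f \<in> borel_measurable M"
  shows "(\<integral>\<^sup>+x. f x \<partial>M) = (\<integral>\<^sup>+x. f x \<partial>density M (indicator P)) + (\<integral>\<^sup>+x. f x \<partial>density M (indicator Q))
    + (\<integral>\<^sup>+x. f x \<partial>density M (indicator R))"
proof -
  note [measurable] = PQR f
  have "(\<integral>\<^sup>+x. f x \<partial>M) = (\<integral>\<^sup>+x. indicator P x * f x + indicator Q x * f x + indicator R x * f x \<partial>M)"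
    using part by (intro nn_integral_cong) (simp flip: distrib_right)
  also have "\<dots> = (\<integral>\<^sup>+x. indicator P x * f x \<partial>M) + (\<integral>\<^sup>+x. indicator Q x * f x \<partial>M) + (\<integral>\<^sup>+x. indicator R x * f x \<partial>M)"
    by (simp add: nn_integral_add)
  finally show ?thesis by (simp add: nn_integral_density)
qed

text \<open>The parts come as restrictions to explicit sets: \<open>Q\<close> collects the atoms,
  \<open>R\<close> is a maximal null set without them, \<open>P\<close> is the remainder.
  Restrictions lie below \<open>M\<close>, which is what the kernel construction requires of its
  input.\<close>

lemma lebesgue_decomposition_exists:
  assumes fin: "finite_measure M" and \<Omega>: "\<Omega> \<in> sets borel" and M: "sets M = sets (restrict_space borel \<Omega>)"
  obtains P Q R where "P \<in> sets M" "Q \<in> sets M" "R \<in> sets M"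
    "\<And>x. x \<in> space M \<Longrightarrow> indicator P x + indicator Q x + indicator R x = (1 :: ennreal)"
    "lebesgue_decomposition M (density M (indicator P)) (density M (indicator Q)) (density M (indicator R))"
proof -
  interpret finite_measure M by fact
  have sp: "space M = \<Omega>"
    using sets_eq_imp_space_eq[OF M] by (simp add: space_restrict_space)
  have sing: "{x} \<in> sets M" if "x \<in> space M" for x
    using that by (auto simp: M sp sets_restrict_space_iff \<Omega>)
  obtain N where N: "N \<in> sets M" "N \<in> null_sets lborel"
    and max: "\<And>B. B \<in> sets M \<Longrightarrow> B \<in> null_sets lborel \<Longrightarrow> emeasure M (B - N) = 0"
    using exists_maximal_null_set[OF fin \<Omega> M] by blast
  define c where "c = {x. measure M {x} \<noteq> 0}"
  have c_sub: "c \<subseteq> space M"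
  proof
    fix x assume "x \<in> c"
    then have "{x} \<in> sets M" unfolding c_def using measure_notin_sets by blast
    then show "x \<in> space M" using sets.sets_into_space by blast
  qed
  have c_count: "countable c" unfolding c_def by (rule countable_support)
  have "(\<Union>x\<in>c. {x}) \<in> sets M"
    using c_count c_sub sing by (intro sets.countable_UN') auto
  then have c: "c \<in> sets M" by simp
  define P where "P = space M - N - c"
  define R where "R = N - c"
  have PR: "P \<in> sets M" "R \<in> sets M" using N c by (auto simp: P_def R_def)
  have part: "indicator P x + indicator c x + indicator R x = (1 :: ennreal)" if "x \<in> space M" for x
    using that by (auto simp: P_def R_def indicator_def)
  have e: "emeasure (density M (indicator X)) B = emeasure M (X \<inter> B)" if "X \<in> sets M" "B \<in> sets M" for X B
    using that by (rule emeasure_restricted)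
  have "lebesgue_decomposition M (density M (indicator P)) (density M (indicator c)) (density M (indicator R))"
    unfolding lebesgue_decomposition_def
  proof (intro conjI ballI)
    have "emeasure M (P \<inter> B) = 0" if B: "B \<in> sets M" "B \<in> null_sets lborel" for B
    proof -
      have "emeasure M (P \<inter> B) \<le> emeasure M (B - N)"
        using B N by (intro emeasure_mono) (auto simp: P_def)
      then show ?thesis using max[OF B] by simp
    qed
    then show "abs_cont (density M (indicator P))"
      by (subst abs_cont_iff[OF \<Omega>]) (use M PR e in auto)
    show "discrete_measure (density M (indicator c))"
      unfolding discrete_measure_def using c c_count e[OF c, of "space M - c"]
      by (intro bexI[of _ c]) auto
    show "singular_measure (density M (indicator R))"
      unfolding singular_measure_def
    proof (intro conjI ballI)
      fix x assume "x \<in> space (density M (indicator R))"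
      then have x: "x \<in> space M" by simp
      have "emeasure M (R \<inter> {x}) = 0"
      proof (cases "x \<in> R")
        case True
        then have "measure M {x} = 0" by (auto simp: R_def c_def)
        then show ?thesis using True by (simp add: emeasure_eq_measure)
      qed simp
      then show "emeasure (density M (indicator R)) {x} = 0"
        using e[OF PR(2) sing[OF x]] by simp
    next
      have "R \<inter> (space M - N) = {}" by (auto simp: R_def)
      then show "\<exists>N'\<in>sets (density M (indicator R)). N' \<in> null_sets lborel \<and>
          emeasure (density M (indicator R)) (space (density M (indicator R)) - N') = 0"
        using N e[OF PR(2), of "space M - N"] by (intro bexI[of _ N]) auto
    qed
    fix B assume "B \<in> sets M"
    then show "emeasure M B = emeasure (density M (indicator P)) B + emeasure (density M (indicator c)) B
        + emeasure (density M (indicator R)) B"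
      using nn_integral_indicator_partition[OF PR(1) c PR(2) part, of "indicator B"] by simp
  qed auto
  from that[OF PR(1) c PR(2) part this] show ?thesis by blast
qed

text \<open>If \<open>M\<close> has one of the three types, then \<open>M\<close> with two zero
  measures is a decomposition, and uniqueness identifies \<open>M\<close> with that part.
  Conversely, a part of mass \<open>1\<close> leaves mass zero for the other two.\<close>

lemma decomposition_mass:
  assumes p: "prob_space M" and \<Omega>: "\<Omega> \<in> sets borel" and M: "sets M = sets (restrict_space borel \<Omega>)"
    and L: "lebesgue_decomposition M A D S"
  shows "abs_cont M \<longleftrightarrow> emeasure A (space M) = 1"
    "discrete_measure M \<longleftrightarrow> emeasure D (space M) = 1"
    "singular_measure M \<longleftrightarrow> emeasure S (space M) = 1"
proof -
  interpret prob_space M by fact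
  have sets: "sets A = sets M" "sets D = sets M" "sets S = sets M"
    and parts: "abs_cont A" "discrete_measure D" "singular_measure S"
    and sum: "\<And>B. B \<in> sets M \<Longrightarrow> emeasure M B = emeasure A B + emeasure D B + emeasure S B"
    using L by (auto simp: lebesgue_decomposition_def)
  have sp: "space A = space M" "space D = space M" "space S = space M"
    using sets by (auto dest: sets_eq_imp_space_eq)
  have total: "emeasure A (space M) + emeasure D (space M) + emeasure S (space M) = 1"
    using sum[of "space M"] emeasure_space_1 by simp
  let ?Z = "null_measure M"
  have Z: "abs_cont ?Z" "discrete_measure ?Z" "singular_measure ?Z"
    unfolding discrete_measure_def singular_measure_def
    by (subst abs_cont_iff[OF \<Omega>]) (use M in \<open>auto intro: bexI[of _ "{}"]\<close>)
  have zero: "emeasure X B = 0" if "emeasure X (space M) = 0" "sets X = sets M" for X B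
  proof (cases "B \<in> sets M")
    case True
    then have "emeasure X B \<le> emeasure X (space M)"
      using that by (intro emeasure_mono sets.sets_into_space) auto
    then show ?thesis using that by simp
  qed (use that in \<open>simp add: emeasure_notin_sets\<close>)
  have cancel: "y = 0 \<and> z = 0" if "(1 :: ennreal) + y + z = 1" for y z
  proof -
    have "1 + (y + z) = 1 + (0 :: ennreal)" using that by (simp add: add.assoc)
    then have "y + z = 0" by (simp only: ennreal_add_left_cancel) simp
    then show ?thesis by simp
  qed
  show "abs_cont M \<longleftrightarrow> emeasure A (space M) = 1"
  proof
    assume "abs_cont M"
    then have "lebesgue_decomposition M M ?Z ?Z" using Z by (simp add: lebesgue_decomposition_def)
    then have "M = A" using lebesgue_decomposition_unique[OF \<Omega> M] L by blast
    then show "emeasure A (space M) = 1" using emeasure_space_1 by simp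
  next
    assume "emeasure A (space M) = 1"
    then have "emeasure D (space M) = 0 \<and> emeasure S (space M) = 0"
      using total by (intro cancel) simp
    then have "M = A" using sum sets by (intro measure_eqI) (simp_all add: zero)
    then show "abs_cont M" using parts by simp
  qed
  show "discrete_measure M \<longleftrightarrow> emeasure D (space M) = 1"
  proof
    assume "discrete_measure M"
    then have "lebesgue_decomposition M ?Z M ?Z" using Z by (simp add: lebesgue_decomposition_def)
    then have "M = D" using lebesgue_decomposition_unique[OF \<Omega> M] L by blast
    then show "emeasure D (space M) = 1" using emeasure_space_1 by simp
  next
    assume "emeasure D (space M) = 1"
    then have "emeasure A (space M) = 0 \<and> emeasure S (space M) = 0"
      using total by (intro cancel) (simp add: add_ac)
    then have "M = D" using sum sets by (intro measure_eqI) (simp_all add: zero)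
    then show "discrete_measure M" using parts by simp
  qed
  show "singular_measure M \<longleftrightarrow> emeasure S (space M) = 1"
  proof
    assume "singular_measure M"
    then have "lebesgue_decomposition M ?Z ?Z M" using Z by (simp add: lebesgue_decomposition_def)
    then have "M = S" using lebesgue_decomposition_unique[OF \<Omega> M] L by blast
    then show "emeasure S (space M) = 1" using emeasure_space_1 by simp
  next
    assume "emeasure S (space M) = 1"
    then have "emeasure A (space M) = 0 \<and> emeasure D (space M) = 0"
      using total by (intro cancel) (simp add: add_ac)
    then have "M = S" using sum sets by (intro measure_eqI) (simp_all add: zero)
    then show "singular_measure M" using parts by simp
  qed
qed

section \<open>Measures on the cube\<close>

text \<open>Rational endpoints make the generator countable; this is what reduces almost sure
  equality of kernels to countably many sets.\<close>

lemma sets_unit_interval_eq_sigma: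
  "sets unit_interval = sets (sigma {0..1} ((\<lambda>a. {0..a}) ` ({0..1} \<inter> \<rat>)))"
proof -
  let ?E = "(\<lambda>a. {0..a}) ` ({0..1::real} \<inter> \<rat>)"
  have E: "?E \<subseteq> Pow {0..1}" by auto
  have "(\<lambda>x::real. x) \<in> measurable (sigma {0..1} ?E) borel"
  proof (rule borel_measurable_iff_less[THEN iffD2], rule allI)
    fix a :: real
    have "{w \<in> space (sigma {0..1} ?E). w < a} =
        (\<Union>r\<in>{r\<in>{0..1} \<inter> \<rat>. r < a}. {0..r}) \<union> (if 1 < a then {0..1} else {})"
      (is "?L = ?R")
    proof (intro equalityI subsetI)
      fix x assume "x \<in> ?L"
      then have x: "0 \<le> x" "x \<le> 1" "x < a" by (auto simp: space_measure_of[OF E])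
      show "x \<in> ?R"
      proof (cases "x = 1")
        case False
        then have "x < min a 1" using x by auto
        then obtain r where "r \<in> \<rat>" "x < r" "r < min a 1" using Rats_dense_in_real by blast
        then show ?thesis using x by (intro UnI1 UN_I[of r]) auto
      qed (use x in auto)
    qed (auto simp: space_measure_of[OF E] split: if_splits)
    also have "\<dots> \<in> sets (sigma {0..1} ?E)"
    proof (intro sets.Un sets.countable_UN')
      show "countable {r \<in> {0..1} \<inter> \<rat>. r < a}"
        by (rule countable_subset[OF _ countable_rat]) auto
      show "(if 1 < a then {0..1} else {}) \<in> sets (sigma {0..1} ?E)"
        using sets.top[of "sigma {0..1} ?E"] by auto
    qed (auto simp: sets_measure_of[OF E])
    finally show "{w \<in> space (sigma {0..1} ?E). w < a} \<in> sets (sigma {0..1} ?E)" .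
  qed
  from measurable_sets[OF this] have "{0..1} \<inter> B \<in> sets (sigma {0..1} ?E)" if "B \<in> sets borel" for B
    using that by (simp add: space_measure_of[OF E] Int_commute[of _ B])
  then have "sets unit_interval \<subseteq> sets (sigma {0..1} ?E)"
    by (auto simp only: sets_restrict_space)
  moreover have "sets (sigma {0..1} ?E) \<subseteq> sets unit_interval"
    unfolding sets_measure_of[OF E]
    by (rule sets.sigma_sets_subset'[where M=unit_interval, simplified])
       (auto simp: sets_restrict_space_iff)
  ultimately show ?thesis by blast
qed

lemma measure_eqI_unit_interval:
  assumes "sets M = sets unit_interval" "sets N = sets unit_interval" "finite_measure M"
    and eq: "\<And>a. a \<in> {0..1} \<inter> \<rat> \<Longrightarrow> emeasure M {0..a} = emeasure N {0..a}"
  shows "M = N"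
proof (rule measure_eqI_generator_eq[where E="(\<lambda>a. {0..a}) ` ({0..1} \<inter> \<rat>)" and \<Omega>="{0..1}" and A="\<lambda>i. {0..1}"])
  show "Int_stable ((\<lambda>a. {0..a}) ` ({0..1::real} \<inter> \<rat>))"
  proof (rule Int_stableI, safe)
    fix a b :: real assume "a \<in> {0..1}" "a \<in> \<rat>" "b \<in> {0..1}" "b \<in> \<rat>"
    then show "{0..a} \<inter> {0..b} \<in> (\<lambda>a. {0..a}) ` ({0..1::real} \<inter> \<rat>)"
      by (intro image_eqI[of _ _ "min a b"]) (auto simp: min_def)
  qed
  show "emeasure M {0..1} \<noteq> \<infinity>"
    using assms(3) by (simp add: finite_measure.emeasure_finite)
  show "range (\<lambda>i::nat. {0..1::real}) \<subseteq> (\<lambda>a. {0..a}) ` ({0..1} \<inter> \<rat>)"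
    by (auto intro!: rev_image_eqI[of 1])
  show "sets M = sigma_sets {0..1} ((\<lambda>a. {0..a}) ` ({0..1} \<inter> \<rat>))"
    "sets N = sigma_sets {0..1} ((\<lambda>a. {0..a}) ` ({0..1} \<inter> \<rat>))"
    by (simp_all add: assms(1,2) sets_unit_interval_eq_sigma image_subset_iff)
qed (use eq in auto)

section \<open>Distribution functions and disintegrations determine measures on the cube\<close>

lemma corner_in_sets_cube: "{x \<in> space (cube d). \<forall>i<d. x i \<le> u i} \<in> sets (cube d)"
proof -
  have "{x \<in> space (cube d). \<forall>i\<in>{..<d}. x i \<le> u i} \<in> sets (cube d)"
  proof (intro sets.sets_Collect_finite_All)
    fix i assume "i \<in> {..<d}"
    then have "(\<lambda>x. x i) \<in> measurable (cube d) unit_interval"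
      by (rule measurable_component_singleton)
    then have "(\<lambda>x. x i) \<in> borel_measurable (cube d)" by (simp add: measurable_restrict_space2_iff)
    then show "{x \<in> space (cube d). x i \<le> u i} \<in> sets (cube d)"
      by (rule borel_measurable_le) simp
  qed auto
  then show ?thesis by (simp only: Ball_def lessThan_iff)
qed

text \<open>A box with sides \<open>{0..a i}\<close> is a corner, so the generator of the product
  algebra already consists of corners.\<close>

lemma sets_cube_eq_sigma:
  "sets (cube d) = sets (sigma (space (cube d))
     {{x \<in> space (cube d). \<forall>i<d. x i \<le> u i} |u. u \<in> space (cube d)})"
    (is "_ = sets (sigma _ ?G)")
proof
  let ?E = "\<lambda>i::nat. (\<lambda>a. {0..a}) ` ({0..1::real} \<inter> \<rat>)"
  have G: "?G \<subseteq> Pow (space (cube d))" by auto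
  have "sets (cube d) = sets (\<Pi>\<^sub>M i\<in>{..<d}. sigma {0..1} (?E i))"
    by (intro sets_PiM_cong) (auto simp: sets_unit_interval_eq_sigma)
  also have "\<dots> = sets (sigma (\<Pi>\<^sub>E i\<in>{..<d}. {0..1})
      {{f\<in>(\<Pi>\<^sub>E i\<in>{..<d}. {0..1}). \<forall>i\<in>j. f i \<in> A i} | A j. j \<in> {{..<d}} \<and> A \<in> Pi j ?E})"
    by (rule sets_PiM_sigma) (auto intro!: exI[of _ "{{0..1}}"])
  also have "\<dots> = sigma_sets (space (cube d))
      {{f\<in>(\<Pi>\<^sub>E i\<in>{..<d}. {0..1}). \<forall>i\<in>j. f i \<in> A i} | A j. j \<in> {{..<d}} \<and> A \<in> Pi j ?E}"
    by (subst sets_measure_of) (auto simp: space_PiM space_restrict_space)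
  also have "\<dots> \<subseteq> sigma_sets (space (cube d)) ?G"
  proof (rule sigma_sets_mono', safe)
    fix A assume "A \<in> Pi {..<d} ?E"
    then have "\<forall>i\<in>{..<d}. \<exists>a. a \<in> {0..1} \<and> A i = {0..a}" by (fastforce simp: Pi_iff)
    then obtain a where a: "\<And>i. i < d \<Longrightarrow> a i \<in> {0..1} \<and> A i = {0..a i}"
      by (metis lessThan_iff)
    let ?u = "restrict a {..<d}"
    have "{f \<in> \<Pi>\<^sub>E i\<in>{..<d}. {0..1}. \<forall>i\<in>{..<d}. f i \<in> A i} = {x \<in> space (cube d). \<forall>i<d. x i \<le> ?u i}"
      using a by (auto simp: space_PiM space_restrict_space)
    moreover have "?u \<in> space (cube d)"
      using a by (auto simp: space_PiM space_restrict_space)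
    ultimately show "\<exists>u. {f \<in> \<Pi>\<^sub>E i\<in>{..<d}. {0..1}. \<forall>i\<in>{..<d}. f i \<in> A i} =
        {x \<in> space (cube d). \<forall>i<d. x i \<le> u i} \<and> u \<in> space (cube d)" by blast
  qed
  finally show "sets (cube d) \<subseteq> sets (sigma (space (cube d)) ?G)"
    by (simp add: sets_measure_of[OF G])
  have "?G \<subseteq> sets (cube d)"
    using corner_in_sets_cube by blast
  then show "sets (sigma (space (cube d)) ?G) \<subseteq> sets (cube d)"
    unfolding sets_measure_of[OF G] by (rule sets.sigma_sets_subset)
qed

text \<open>Corners are stable under intersection, by the coordinatewise minimum, and the corner at
  all ones is the whole cube. This resolves the definite description in
  \<open>copula_measure\<close>.\<close>

lemma has_cdf_unique:
  assumes M: "has_cdf d M C" and M': "has_cdf d M' C"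
  shows "M = M'"
proof -
  interpret M: prob_space M using M by (simp add: has_cdf_def)
  interpret M': prob_space M' using M' by (simp add: has_cdf_def)
  let ?B = "\<lambda>u. {x \<in> space (cube d). \<forall>i<d. x i \<le> u i}"
  let ?one = "\<lambda>i\<in>{..<d}. 1 :: real"
  let ?G = "{?B u |u. u \<in> space (cube d)}"
  have s: "sets M = sets (cube d)" "sets M' = sets (cube d)"
    using M M' by (auto simp: has_cdf_def)
  have G: "?G \<subseteq> Pow (space (cube d))" by auto
  have one: "?one \<in> space (cube d)" by (auto simp: space_PiM space_restrict_space)
  have "x i \<le> 1" if "x \<in> space (cube d)" "i < d" for x i
    using that PiE_mem[of x "{..<d}" "\<lambda>_. {0..1}" i] by (simp add: space_PiM space_restrict_space)
  then have Bone: "?B ?one = space (cube d)" by auto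
  show ?thesis
  proof (rule measure_eqI_generator_eq[where E="?G" and \<Omega>="space (cube d)" and A="\<lambda>i. ?B ?one"])
    show "Int_stable ?G"
    proof (rule Int_stableI, safe)
      fix u v assume u: "u \<in> space (cube d)" and v: "v \<in> space (cube d)"
      let ?w = "\<lambda>i\<in>{..<d}. min (u i) (v i)"
      have "?B u \<inter> ?B v = ?B ?w" by auto
      moreover have "?w \<in> space (cube d)"
        using u v by (auto simp: space_PiM space_restrict_space PiE_iff min_def)
      ultimately show "\<exists>w. ?B u \<inter> ?B v = ?B w \<and> w \<in> space (cube d)" by blast
    qed
    show "emeasure M X = emeasure M' X" if "X \<in> ?G" for X
      using that M M' by (auto simp: has_cdf_def M.emeasure_eq_measure M'.emeasure_eq_measure)
    show "sets M = sigma_sets (space (cube d)) ?G" "sets M' = sigma_sets (space (cube d)) ?G"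
      using s sets_measure_of[OF G] sets_cube_eq_sigma[of d] by auto
    show "range (\<lambda>i. ?B ?one) \<subseteq> ?G" using one by blast
    show "(\<Union>i. ?B ?one) = space (cube d)" using Bone by auto
  qed (use G in auto)
qed

lemma copula_measure_eqI: "has_cdf d M C \<Longrightarrow> copula_measure d C = M"
  unfolding copula_measure_def using has_cdf_unique by blast

text \<open>Every box is a rectangle of the kind that a disintegration prescribes, and boxes
  determine a finite measure. This resolves the definite description in
  \<open>copula_component\<close>.\<close>

lemma disintegrates_unique:
  assumes M: "disintegrates (Suc n) M \<nu> \<kappa>" and M': "disintegrates (Suc n) M' \<nu> \<kappa>"
    and fin: "finite_measure M"
  shows "M = M'"
proof (rule measure_eqI_PiM_finite[where I="{..<Suc n}" and M="\<lambda>_. unit_interval" and A="\<lambda>_. space (cube (Suc n))"])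
  show "sets M = sets (cube (Suc n))" "sets M' = sets (cube (Suc n))"
    using M M' by (auto simp: disintegrates_def)
  fix A :: "nat \<Rightarrow> real set" assume A: "\<And>i. i \<in> {..<Suc n} \<Longrightarrow> A i \<in> sets unit_interval"
  have sub: "A i \<subseteq> {0..1}" if "i < Suc n" for i
    using A[of i] that sets.sets_into_space[of "A i" unit_interval] by (simp add: space_restrict_space)
  have 1: "Pi\<^sub>E {..<Suc n} A = {x \<in> space (cube (Suc n)). restrict x {..<n} \<in> Pi\<^sub>E {..<n} A \<and> x n \<in> A n}"
  proof (intro set_eqI iffI)
    fix x assume x: "x \<in> Pi\<^sub>E {..<Suc n} A"
    then have "x i \<in> {0..1}" if "i < Suc n" for i
      using sub[OF that] PiE_mem[OF x, of i] that by blast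
    with x show "x \<in> {x \<in> space (cube (Suc n)). restrict x {..<n} \<in> Pi\<^sub>E {..<n} A \<and> x n \<in> A n}"
      by (auto simp: space_PiM space_restrict_space PiE_iff)
  qed (auto simp: space_PiM PiE_iff less_Suc_eq)
  have 2: "Pi\<^sub>E {..<n} A \<in> sets (cube n)"
    using A by (intro sets_PiM_I_finite) auto
  have 3: "emeasure M {x \<in> space (cube (Suc n)). restrict x {..<n} \<in> E \<and> x n \<in> F} =
      emeasure M' {x \<in> space (cube (Suc n)). restrict x {..<n} \<in> E \<and> x n \<in> F}"
    if "E \<in> sets (cube n)" "F \<in> sets unit_interval" for E F
    using M M' that by (simp add: disintegrates_def)
  have "A n \<in> sets unit_interval" by (rule A) simp
  then show "emeasure M (Pi\<^sub>E {..<Suc n} A) = emeasure M' (Pi\<^sub>E {..<Suc n} A)"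
    unfolding 1 by (rule 3[OF 2])
next
  have "space (cube (Suc n)) \<in> prod_algebra {..<Suc n} (\<lambda>_. unit_interval)"
    unfolding space_PiM by (intro prod_algebraI_finite ballI sets.top finite_lessThan)
  then show "range (\<lambda>_::nat. space (cube (Suc n))) \<subseteq> prod_algebra {..<Suc n} (\<lambda>_. unit_interval)"
    by blast
  show "emeasure M (space (cube (Suc n))) \<noteq> \<infinity>"
    using fin by (simp add: finite_measure.emeasure_finite)
qed auto

text \<open>For fixed \<open>F\<close> the two integrands are densities of the same finite measure,
  hence equal almost everywhere. The rational intervals yield one exceptional null set for all
  \<open>F\<close>. \<open>\<kappa>\<close> may be sub-Markov, since the explicit kernel is the zero
  measure where its normalising constant is \<open>0\<close>.\<close>

lemma kernel_AE_unique:
  assumes \<nu>: "finite_measure \<nu>" "sets \<nu> = sets (cube n)"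
    and K: "K \<in> measurable (cube n) (prob_algebra unit_interval)"
    and \<kappa>: "\<And>y. sets (\<kappa> y) = sets unit_interval"
      "\<And>F. F \<in> sets unit_interval \<Longrightarrow> (\<lambda>y. emeasure (\<kappa> y) F) \<in> borel_measurable (cube n)"
    and eq: "\<And>E F. E \<in> sets (cube n) \<Longrightarrow> F \<in> sets unit_interval \<Longrightarrow>
      (\<integral>\<^sup>+y\<in>E. emeasure (K y) F \<partial>\<nu>) = (\<integral>\<^sup>+y\<in>E. emeasure (\<kappa> y) F \<partial>\<nu>)"
  shows "AE y in \<nu>. K y = \<kappa> y"
proof -
  interpret \<nu>: finite_measure \<nu> by fact
  have meas: "borel_measurable \<nu> = borel_measurable (cube n)"
    using \<nu>(2) by (rule measurable_cong_sets) auto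
  have Ks: "K \<in> measurable (cube n) (subprob_algebra unit_interval)"
    using K by (rule measurable_prob_algebraD)
  have Kp: "prob_space (K y)" "sets (K y) = sets unit_interval" if "y \<in> space \<nu>" for y
    using measurable_space[OF K, of y] that sets_eq_imp_space_eq[OF \<nu>(2)]
    by (auto simp: space_prob_algebra)
  have "AE y in \<nu>. emeasure (K y) F = emeasure (\<kappa> y) F" if F: "F \<in> sets unit_interval" for F
  proof (rule finite_density_unique[THEN iffD1])
    show m1: "(\<lambda>y. emeasure (K y) F) \<in> borel_measurable \<nu>"
      unfolding meas using measurable_compose[OF Ks measurable_emeasure_subprob_algebra[OF F]] by simp
    show m2: "(\<lambda>y. emeasure (\<kappa> y) F) \<in> borel_measurable \<nu>"
      unfolding meas by (rule \<kappa>(2)[OF F])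
    have "(\<integral>\<^sup>+y. emeasure (K y) F \<partial>\<nu>) \<le> (\<integral>\<^sup>+y. 1 \<partial>\<nu>)"
      using Kp by (intro nn_integral_mono) (auto intro: prob_space.measure_le_1)
    also have "\<dots> < \<infinity>" using \<nu>.emeasure_finite[of "space \<nu>"] by (simp add: less_top[symmetric])
    finally show "(\<integral>\<^sup>+y. emeasure (K y) F \<partial>\<nu>) \<noteq> \<infinity>" by simp
    show "density \<nu> (\<lambda>y. emeasure (K y) F) = density \<nu> (\<lambda>y. emeasure (\<kappa> y) F)"
      using m1 m2 eq[OF _ F] \<nu>(2) by (intro measure_eqI) (auto simp: emeasure_density)
    show "AE y in \<nu>. 0 \<le> emeasure (K y) F" "AE y in \<nu>. 0 \<le> emeasure (\<kappa> y) F" by simp_all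
  qed
  then have "AE y in \<nu>. \<forall>a\<in>{0..1} \<inter> \<rat>. emeasure (K y) {0..a} = emeasure (\<kappa> y) {0..a}"
    by (subst AE_ball_countable) (auto intro: countable_Int2 countable_rat simp: sets_restrict_space_iff)
  with AE_space[of \<nu>] show ?thesis
  proof eventually_elim
    case (elim y)
    interpret K: prob_space "K y" using Kp(1) elim(1) by blast
    show ?case
      using Kp(2)[OF elim(1)] \<kappa>(1) K.finite_measure_axioms
      by (rule measure_eqI_unit_interval) (use elim(2) in blast)
  qed
qed

text \<open>Induction on the coordinates: fixing coordinate \<open>j\<close> at \<open>y\<close>
  leaves a simplex of the same shape with bound \<open>b - y\<close>, and the slice volumes
  integrate to the next power. The corner \<open>a\<close> is arbitrary because the lower bounds
  will be pseudo-inverses of the arguments of the copula.\<close>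

lemma emeasure_shifted_simplex:
  fixes a :: "'a \<Rightarrow> real"
  assumes "finite A" "sum a A \<le> b"
  shows "emeasure (Pi\<^sub>M A (\<lambda>_. lborel)) {x \<in> space (Pi\<^sub>M A (\<lambda>_. lborel)). (\<forall>i\<in>A. a i \<le> x i) \<and> sum x A \<le> b}
    = ennreal ((b - sum a A) ^ card A / fact (card A))"
  using assms
proof (induction arbitrary: b rule: finite_induct)
  case empty
  then show ?case by (simp add: PiM_empty)
next
  case (insert j A b)
  let ?M = "\<lambda>A. Pi\<^sub>M A (\<lambda>_. lborel :: real measure)"
  let ?S = "\<lambda>A b. {x \<in> space (?M A). (\<forall>i\<in>A. a i \<le> x i) \<and> sum x A \<le> b}"
  have meas [measurable]: "?S A b \<in> sets (?M A)" if "finite A" for A :: "'a set" and b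
    using that by measurable
  have "finite (insert j A)" using insert.hyps by simp
  let ?c = "b - sum a A"
  let ?k = "card A"
  have c: "a j \<le> ?c" using insert by simp
  interpret product_sigma_finite "\<lambda>_. lborel :: real measure"
    by standard
  have "emeasure (?M (insert j A)) (?S (insert j A) b) = (\<integral>\<^sup>+x. indicator (?S (insert j A) b) x \<partial>?M (insert j A))"
    using meas[OF \<open>finite (insert j A)\<close>] by (simp only: nn_integral_indicator)
  also have "\<dots> = (\<integral>\<^sup>+y. \<integral>\<^sup>+x. indicator (?S (insert j A) b) (x(j := y)) \<partial>?M A \<partial>lborel)"
    using insert.hyps meas[OF \<open>finite (insert j A)\<close>]
    by (intro product_nn_integral_insert_rev borel_measurable_indicator) auto
  also have "\<dots> = (\<integral>\<^sup>+y. indicator {a j..?c} y * ennreal ((?c - y) ^ ?k / fact ?k) \<partial>lborel)"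
  proof (intro nn_integral_cong)
    fix y :: real
    have eq: "x(j := y) \<in> ?S (insert j A) b \<longleftrightarrow> y \<in> {a j..?c} \<and> x \<in> ?S A (b - y)" if "x \<in> space (?M A)" for x
    proof -
      have 1: "sum (x(j := y)) A = sum x A"
        using insert.hyps by (intro sum.cong) auto
      have 2: "(\<forall>i\<in>A. a i \<le> (x(j := y)) i) \<longleftrightarrow> (\<forall>i\<in>A. a i \<le> x i)"
        using insert.hyps by auto
      have 3: "x(j := y) \<in> space (?M (insert j A))"
        using that by (auto simp: space_PiM PiE_iff extensional_def)
      have 4: "sum a A \<le> sum x A" if "\<forall>i\<in>A. a i \<le> x i"
        using that by (intro sum_mono) auto
      show ?thesis
        using insert.hyps that 3 4 by (simp add: 1 2) (use 1 2 in fastforce)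
    qed
    have "(\<integral>\<^sup>+x. indicator (?S (insert j A) b) (x(j := y)) \<partial>?M A) =
        (\<integral>\<^sup>+x. indicator {a j..?c} y * indicator (?S A (b - y)) x \<partial>?M A)"
      using eq by (intro nn_integral_cong) (simp only: indicator_def, simp)
    also have "\<dots> = indicator {a j..?c} y * emeasure (?M A) (?S A (b - y))"
      using meas[OF insert.hyps(1)] by (subst nn_integral_cmult) (auto simp only: nn_integral_indicator intro!: borel_measurable_indicator)
    \<comment> \<open>The induction hypothesis requires \<open>sum a A \<le> b - y\<close>, that is
      \<open>y \<le> ?c\<close>; for larger \<open>y\<close> the indicator makes both sides
      \<open>0\<close>.\<close>
    also have "\<dots> = indicator {a j..?c} y * ennreal ((?c - y) ^ ?k / fact ?k)"
      using insert.IH[of "b - y"] by (cases "y \<le> ?c") (simp_all add: algebra_simps)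
    finally show "(\<integral>\<^sup>+x. indicator (?S (insert j A) b) (x(j := y)) \<partial>?M A) =
        indicator {a j..?c} y * ennreal ((?c - y) ^ ?k / fact ?k)" .
  qed
  also have "\<dots> = (\<integral>\<^sup>+y\<in>{a j..?c}. ennreal ((?c - y) ^ ?k / fact ?k) \<partial>lborel)"
    by (simp add: mult.commute)
  also have "\<dots> = ennreal (- ((?c - ?c) ^ Suc ?k / fact (Suc ?k)) - (- ((?c - a j) ^ Suc ?k / fact (Suc ?k))))"
  proof (rule nn_integral_FTC_Icc[where F="\<lambda>y. - ((?c - y) ^ Suc ?k / fact (Suc ?k))", OF _ _ _ c])
    fix y assume "y \<in> {a j..?c}"
    have "((\<lambda>y. - ((?c - y) ^ Suc ?k / fact (Suc ?k))) has_real_derivative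
        (real (Suc ?k) * (?c - y) ^ ?k) / fact (Suc ?k)) (at y)"
      by (rule derivative_eq_intros refl | simp)+
    moreover have "(real (Suc ?k) * (?c - y) ^ ?k) / fact (Suc ?k) = (?c - y) ^ ?k / fact ?k"
      by (simp add: fact_Suc del: of_nat_Suc)
    ultimately show "((\<lambda>y. - ((?c - y) ^ Suc ?k / fact (Suc ?k))) has_real_derivative (?c - y) ^ ?k / fact ?k) (at y)"
      by (simp only:)
  qed auto
  finally show ?case
    using insert.hyps by (simp add: algebra_simps)
qed

text \<open>Along one coordinate the hyperplane meets each line in a single point. The values to be
  avoided later are \<open>0\<close>, where the kernel may not be normalisable, and
  \<open>1 / t\<close>, a face of the simplex.\<close>

lemma AE_sum_neq:
  assumes "finite A" "A \<noteq> {}"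
  shows "AE x in Pi\<^sub>M A (\<lambda>_. lborel :: real measure). sum x A \<noteq> c"
proof -
  obtain j B where A: "A = insert j B" "j \<notin> B" "finite B"
    using assms by (metis all_not_in_conv finite_insert mk_disjoint_insert)
  let ?M = "\<lambda>A. Pi\<^sub>M A (\<lambda>_. lborel :: real measure)"
  interpret product_sigma_finite "\<lambda>_. lborel :: real measure"
    by standard
  let ?N = "{x \<in> space (?M A). sum x A = c}"
  have N: "?N \<in> sets (?M A)" using assms by measurable
  have "emeasure (?M A) ?N = (\<integral>\<^sup>+x. indicator ?N x \<partial>?M A)"
    using N by (simp only: nn_integral_indicator)
  also have "\<dots> = (\<integral>\<^sup>+x. \<integral>\<^sup>+y. indicator ?N (x(j := y)) \<partial>lborel \<partial>?M B)"
    using A N unfolding A(1) by (intro product_nn_integral_insert borel_measurable_indicator) auto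
  also have "\<dots> = (\<integral>\<^sup>+x. 0 \<partial>?M B)"
  proof (intro nn_integral_cong)
    fix x :: "'a \<Rightarrow> real"
    have "sum (x(j := y)) B = sum x B" for y
      using A by (intro sum.cong) auto
    then have "(\<integral>\<^sup>+y. indicator ?N (x(j := y)) \<partial>lborel) \<le> (\<integral>\<^sup>+y. indicator {c - sum x B} y \<partial>lborel)"
      using A by (intro nn_integral_mono) (auto simp: indicator_def)
    then show "(\<integral>\<^sup>+y. indicator ?N (x(j := y)) \<partial>lborel) = 0"
      by simp
  qed
  finally have "?N \<in> null_sets (?M A)" using N by auto
  then show ?thesis
    by (rule AE_I') auto
qed

section \<open>The Williamson transform\<close>

lemma convex_on_power_nonneg: "convex_on {0..} (\<lambda>x::real. x ^ n)"
proof (induction n)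
  case (Suc n)
  have "convex_on {0..} (\<lambda>x::real. x * x ^ n)"
    by (rule convex_on_mul)
       (use Suc in \<open>auto simp: convex_on_ident mono_on_def intro: power_mono\<close>)
  then show ?case by simp
qed (simp add: convex_on_const)

locale williamson_measure = prob_space \<gamma> for \<gamma> :: "real measure" +
  fixes n :: nat
  assumes n_pos: "n > 0"
    and sets_gamma: "sets \<gamma> = sets (restrict_space borel {0..})"
    and gamma_zero: "emeasure \<gamma> {0} = 0"
begin

lemma space_gamma: "space \<gamma> = {0..}"
  using sets_eq_imp_space_eq[OF sets_gamma] by (simp add: space_restrict_space)

lemma measurable_id_gamma [measurable (raw)]: "(\<lambda>t. t) \<in> borel_measurable \<gamma>"
  unfolding measurable_cong_sets[OF sets_gamma refl] by (rule measurable_restrict_space1) simp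

lemma AE_gamma_pos: "AE t in \<gamma>. 0 < t"
proof (rule AE_I[of _ _ "{0}"])
  show "{0} \<in> sets \<gamma>" by (auto simp: sets_gamma sets_restrict_space_iff)
qed (auto simp: space_gamma gamma_zero)

text \<open>Clamping the argument at \<open>0\<close> makes \<open>psi\<close> continuous with values in \<open>[0,1]\<close> on the whole line.\<close>

definition kern :: "real \<Rightarrow> real \<Rightarrow> real" where
  "kern z t = (max 0 (1 - t * max 0 z)) ^ n"

definition psi :: "real \<Rightarrow> real" where
  "psi z = (LINT t|\<gamma>. kern z t)"

section \<open>Monotonicity, convexity and limits of the transform\<close>

lemma psi_eq: "0 \<le> z \<Longrightarrow> psi z = williamson_generator (Suc n) \<gamma> z"
  by (simp add: psi_def kern_def williamson_generator_def max_def)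

lemma kern_bounds: "0 \<le> t \<Longrightarrow> 0 \<le> kern z t \<and> kern z t \<le> 1"
  by (auto simp: kern_def intro!: power_le_one)

lemma measurable_kern [measurable]: "kern z \<in> borel_measurable \<gamma>"
  unfolding kern_def by measurable

lemma integrable_kern [simp]: "integrable \<gamma> (kern z)"
proof (rule integrable_const_bound[where B=1])
  show "AE t in \<gamma>. norm (kern z t) \<le> 1"
    using kern_bounds by (intro AE_I2) (auto simp: space_gamma)
qed simp

lemma kern_antimono: "x \<le> y \<Longrightarrow> 0 \<le> t \<Longrightarrow> kern y t \<le> kern x t"
  unfolding kern_def by (intro power_mono max.mono diff_left_mono mult_left_mono) auto

lemma psi_nonneg: "0 \<le> psi z"
  unfolding psi_def using kern_bounds by (intro integral_nonneg_AE AE_I2) (auto simp: space_gamma)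

lemma psi_nonpos_arg: "z \<le> 0 \<Longrightarrow> psi z = 1"
  by (simp add: psi_def kern_def max_def prob_space)

lemma psi_antimono: "x \<le> y \<Longrightarrow> psi y \<le> psi x"
  unfolding psi_def using kern_antimono by (intro integral_mono) (auto simp: space_gamma)

lemma psi_le_one: "psi z \<le> 1"
  using psi_antimono[of 0 z] psi_nonpos_arg[of 0] psi_nonpos_arg[of z] by (cases "0 \<le> z") auto

text \<open>For fixed \<open>t\<close> the clamped affine function of the argument is convex and
  nonnegative, and taking the \<open>n\<close>-th power is increasing and convex on such values.
  Integration preserves the inequality.\<close>

lemma psi_convex:
  assumes "0 \<le> u" "u \<le> 1" "0 \<le> x" "0 \<le> y"
  shows "psi ((1 - u) * x + u * y) \<le> (1 - u) * psi x + u * psi y"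
proof -
  have "kern ((1 - u) * x + u * y) t \<le> (1 - u) * kern x t + u * kern y t" if "0 \<le> t" for t
  proof -
    let ?m = "\<lambda>z. max 0 (1 - t * z)"
    have "1 - t * ((1 - u) * x + u * y) = (1 - u) * (1 - t * x) + u * (1 - t * y)"
      by (simp add: algebra_simps)
    also have "\<dots> \<le> (1 - u) * ?m x + u * ?m y"
      using assms by (intro add_mono mult_left_mono) auto
    finally have "?m ((1 - u) * x + u * y) \<le> (1 - u) * ?m x + u * ?m y"
      using assms by simp
    then have "?m ((1 - u) * x + u * y) ^ n \<le> ((1 - u) * ?m x + u * ?m y) ^ n"
      by (rule power_mono) simp
    also have "\<dots> \<le> (1 - u) * ?m x ^ n + u * ?m y ^ n"
      using convex_onD[OF convex_on_power_nonneg[of n], of u "?m x" "?m y"] assms by simp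
    finally show ?thesis using assms by (simp add: kern_def max_def[of 0 x] max_def[of 0 y] max_def[of 0 "_ + _"])
  qed
  then have "psi ((1 - u) * x + u * y) \<le> (LINT t|\<gamma>. (1 - u) * kern x t + u * kern y t)"
    unfolding psi_def by (intro integral_mono) (auto simp: space_gamma)
  then show ?thesis by (simp add: psi_def)
qed

text \<open>Convexity with denominators cleared, the form in which all comparisons of slopes below
  are made.\<close>

lemma psi_slope:
  assumes "0 \<le> x" "x < y" "y < w"
  shows "psi y * (w - x) \<le> psi x * (w - y) + psi w * (y - x)"
proof -
  define u where "u = (y - x) / (w - x)"
  have u: "0 \<le> u" "u \<le> 1" "1 - u = (w - y) / (w - x)"
    using assms by (auto simp: u_def field_simps)
  have "(1 - u) * x + u * w = y"
    using assms unfolding u(3) by (simp add: u_def divide_simps) (simp add: algebra_simps)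
  then have "psi y \<le> (1 - u) * psi x + u * psi w"
    using psi_convex[of u x w] u(1,2) assms by simp
  then have "psi y * (w - x) \<le> ((1 - u) * psi x + u * psi w) * (w - x)"
    using assms by (intro mult_right_mono) auto
  also have "\<dots> = psi x * ((1 - u) * (w - x)) + psi w * (u * (w - x))"
    by (simp add: algebra_simps)
  also have "(1 - u) * (w - x) = w - y" using assms by (simp add: u(3))
  also have "u * (w - x) = y - x" using assms by (simp add: u_def)
  finally show ?thesis .
qed

lemma psi_continuous: "isCont psi z"
  unfolding continuous_at_sequentially o_def
proof (intro allI impI)
  fix X assume X: "X \<longlonglongrightarrow> z"
  show "(\<lambda>i. psi (X i)) \<longlonglongrightarrow> psi z"
    unfolding psi_def
  proof (rule integral_dominated_convergence[where w="\<lambda>_. 1"])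
    show "AE t in \<gamma>. (\<lambda>i. kern (X i) t) \<longlonglongrightarrow> kern z t"
      unfolding kern_def by (intro AE_I2 tendsto_intros X)
    show "AE t in \<gamma>. norm (kern (X i) t) \<le> 1" for i
      using kern_bounds by (intro AE_I2) (auto simp: space_gamma)
  qed auto
qed

lemma psi_measurable [measurable]: "psi \<in> borel_measurable borel"
  by (intro borel_measurable_continuous_onI continuous_at_imp_continuous_on ballI psi_continuous)

lemma psi_tendsto_0: "(\<lambda>i. psi (real i)) \<longlonglongrightarrow> 0"
proof -
  have "(\<lambda>i. psi (real i)) \<longlonglongrightarrow> (LINT t|\<gamma>. 0)"
    unfolding psi_def
  proof (rule integral_dominated_convergence[where w="\<lambda>_. 1"])
    show "AE t in \<gamma>. (\<lambda>i. kern (real i) t) \<longlonglongrightarrow> 0"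
      using AE_gamma_pos
    proof eventually_elim
      case (elim t)
      have "eventually (\<lambda>i. 1 / t \<le> real i) sequentially"
        by real_asymp
      \<comment> \<open>Positivity of \<open>n\<close> matters here: the clamped base is
        \<open>0\<close>, and \<open>0 ^ 0\<close> would be \<open>1\<close>.\<close>
      then have "eventually (\<lambda>i. kern (real i) t = 0) sequentially"
        by eventually_elim (use elim n_pos in \<open>auto simp: kern_def field_simps max_def\<close>)
      then show ?case by (rule tendsto_eventually)
    qed
    show "AE t in \<gamma>. norm (kern (real i) t) \<le> 1" for i
      using kern_bounds by (intro AE_I2) (auto simp: space_gamma)
  qed auto
  then show ?thesis by simp
qed

lemma psi_small:
  assumes "0 < e"
  obtains w where "z < w" "psi w < e"
proof -
  have "eventually (\<lambda>i. psi (real i) < e) sequentially"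
    using psi_tendsto_0 assms by (rule order_tendstoD)
  moreover have "eventually (\<lambda>i. z < real i) sequentially"
    by real_asymp
  ultimately have "eventually (\<lambda>i. psi (real i) < e \<and> z < real i) sequentially"
    by eventually_elim auto
  then show ?thesis using that by (auto simp: eventually_sequentially)
qed

text \<open>A convex function tending to \<open>0\<close> cannot stay constant at a positive level:
  \<open>psi y\<close> is at most the value of the chord from \<open>x\<close> to a later point
  \<open>w\<close> where \<open>psi\<close> is smaller.\<close>

lemma psi_strict:
  assumes "0 \<le> x" "x < y" "0 < psi x"
  shows "psi y < psi x"
proof -
  obtain w where w: "y < w" "psi w < psi x" using psi_small[OF assms(3)] by blast
  have "psi y * (w - x) \<le> psi x * (w - y) + psi w * (y - x)"
    using assms w by (intro psi_slope) auto
  also have "\<dots> < psi x * (w - y) + psi x * (y - x)"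
    using assms w by simp
  also have "\<dots> = psi x * (w - x)" by (simp add: algebra_simps)
  finally show ?thesis using assms w by simp
qed

lemma psi_surj:
  assumes "0 < y" "y \<le> 1"
  obtains z where "0 \<le> z" "psi z = y"
proof -
  obtain w where w: "0 < w" "psi w < y" using psi_small[OF assms(1)] by blast
  have "\<exists>z\<ge>0. z \<le> w \<and> psi z = y"
    using w assms psi_nonpos_arg[of 0] psi_continuous by (intro IVT2) auto
  then show ?thesis using that by blast
qed

text \<open>A real-valued inverse, with default \<open>0\<close> for nonpositive \<open>y\<close>,
  where the pseudo-inverse may be infinite. The infimum uses \<open>psi x \<le> y\<close> instead of
  equality, so that the function is monotone on all positive reals and hence Borel.\<close>

definition psi_inv :: "real \<Rightarrow> real" where
  "psi_inv y = (if 0 < y then Inf {x. 0 \<le> x \<and> psi x \<le> y} else 0)"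

lemma psi_inv_psi: "0 \<le> z \<Longrightarrow> 0 < psi z \<Longrightarrow> psi_inv (psi z) = z"
  unfolding psi_inv_def
proof (simp, rule cInf_eq_minimum)
  fix x assume "0 \<le> z" "0 < psi z" "x \<in> {x. 0 \<le> x \<and> psi x \<le> psi z}"
  then show "z \<le> x"
    using psi_strict[of x z] psi_antimono[of x z] by (cases "x < z") auto
qed auto

lemma psi_inv_measurable [measurable]: "psi_inv \<in> borel_measurable borel"
proof -
  have "mono_on {0<..} (\<lambda>y. - Inf {x. 0 \<le> x \<and> psi x \<le> y})"
  proof (rule mono_onI, simp, rule cInf_superset_mono)
    fix r s :: real assume r: "0 < r" "r \<le> s"
    obtain w where "0 < w" "psi w < r" using psi_small[OF r(1)] by blast
    then have "w \<in> {x. 0 \<le> x \<and> psi x \<le> r}" by simp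
    then show "{x. 0 \<le> x \<and> psi x \<le> r} \<noteq> {}" by blast
    show "{x. 0 \<le> x \<and> psi x \<le> r} \<subseteq> {x. 0 \<le> x \<and> psi x \<le> s}"
      using r by auto
  qed (auto intro: bdd_belowI[of _ 0])
  from borel_measurable_mono_on_fnc[OF this]
  have "(\<lambda>y. - (- Inf {x. 0 \<le> x \<and> psi x \<le> y})) \<in> borel_measurable (restrict_space borel {0<..})"
    by (rule borel_measurable_uminus)
  then have "(\<lambda>y. if y \<in> {0<..} then - (- Inf {x. 0 \<le> x \<and> psi x \<le> y}) else 0) \<in> borel_measurable borel"
    by (rule measurable_restrict_space_iff[THEN iffD1, rotated 2]) auto
  then show ?thesis
    unfolding psi_inv_def greaterThan_iff minus_minus .
qed

text \<open>By convexity no chord to the right of a point is steeper than the chord joining that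
  point to \<open>0\<close>. The latter falls by at most \<open>1\<close> over a length of at least
  \<open>z / 2\<close>, since both points lie beyond \<open>z / 2\<close>; hence the constant
  \<open>2 / z\<close>.\<close>

lemma psi_locally_Lipschitz:
  assumes "0 < z" "z / 2 < z'"
  shows "\<bar>psi z' - psi z\<bar> \<le> 2 / z * \<bar>z' - z\<bar>"
proof (cases z z' rule: linorder_cases)
  case less
  have "psi z * (z' - 0) \<le> psi 0 * (z' - z) + psi z' * (z - 0)"
    using less assms by (intro psi_slope) auto
  then have "z * (psi z - psi z') \<le> (1 - psi z) * (z' - z)"
    by (simp add: psi_nonpos_arg algebra_simps)
  also have "\<dots> \<le> 1 * (z' - z)"
    using less psi_nonneg[of z] by (intro mult_right_mono) auto
  also have "\<dots> \<le> 2 * (z' - z)" using less by simp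
  finally have "psi z - psi z' \<le> 2 / z * (z' - z)" using assms by (simp add: field_simps)
  then show ?thesis using less psi_antimono[of z z'] by simp
next
  case greater
  have "psi z' * (z - 0) \<le> psi 0 * (z - z') + psi z * (z' - 0)"
    using greater assms by (intro psi_slope) auto
  then have "z' * (psi z' - psi z) \<le> (1 - psi z') * (z - z')"
    by (simp add: psi_nonpos_arg algebra_simps)
  also have "\<dots> \<le> 1 * (z - z')"
    using greater psi_nonneg[of z'] by (intro mult_right_mono) auto
  finally have 1: "z' * (psi z' - psi z) \<le> z - z'" by simp
  have "z / 2 * (psi z' - psi z) \<le> z' * (psi z' - psi z)"
    using greater assms psi_antimono[of z' z] by (intro mult_right_mono) auto
  with 1 have "psi z' - psi z \<le> 2 / z * (z - z')" using assms by (simp add: field_simps)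
  then show ?thesis using greater psi_antimono[of z' z] by simp
qed auto

text \<open>Here the slope of \<open>psi\<close> must be bounded away from zero. Take
  \<open>c\<close> beyond \<open>z\<close> with \<open>psi c < psi z\<close>: to the left of
  \<open>c\<close>, chords through \<open>z\<close> fall at least as fast as the chord from
  \<open>z\<close> to \<open>c\<close>, whose reciprocal steepness is \<open>B\<close>. The
  condition \<open>psi c < b'\<close> keeps the second point to the left of
  \<open>c\<close>.\<close>

lemma psi_inv_locally_Lipschitz:
  assumes "0 < b" "b \<le> 1"
  obtains T B where "open T" "b \<in> T"
    "\<And>b'. b' \<in> T \<Longrightarrow> 0 < b' \<Longrightarrow> b' \<le> 1 \<Longrightarrow> \<bar>psi_inv b' - psi_inv b\<bar> \<le> B * \<bar>b' - b\<bar>"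
proof -
  obtain z where z: "0 \<le> z" "psi z = b" using psi_surj[OF assms] by blast
  obtain c where c: "z < c" "psi c < b" using psi_small[OF assms(1)] by blast
  define B where "B = (c - z) / (psi z - psi c)"
  show ?thesis
  proof
    show "open {psi c<..}" "b \<in> {psi c<..}" using c by auto
    fix b' assume b': "b' \<in> {psi c<..}" "0 < b'" "b' \<le> 1"
    obtain z' where z': "0 \<le> z'" "psi z' = b'" using psi_surj[OF b'(2,3)] by blast
    have "z' < c" using b' z' psi_antimono[of c z'] by (cases "z' < c") auto
    have "(psi z - psi c) * \<bar>z' - z\<bar> \<le> (c - z) * \<bar>psi z' - psi z\<bar>"
    proof (cases z z' rule: linorder_cases)
      case less
      have "psi z' * (c - z) \<le> psi z * (c - z') + psi c * (z' - z)"
        using less z \<open>z' < c\<close> by (intro psi_slope) auto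
      then show ?thesis using less psi_antimono[of z z'] by (simp add: algebra_simps)
    next
      case greater
      have "psi z * (c - z') \<le> psi z' * (c - z) + psi c * (z - z')"
        using greater z' c by (intro psi_slope) auto
      then show ?thesis using greater psi_antimono[of z' z] by (simp add: algebra_simps)
    qed auto
    then have "\<bar>z' - z\<bar> \<le> B * \<bar>b' - b\<bar>"
      using c z z' by (simp add: B_def field_simps)
    then show "\<bar>psi_inv b' - psi_inv b\<bar> \<le> B * \<bar>b' - b\<bar>"
      using z z' b' assms psi_inv_psi[of z] psi_inv_psi[of z'] by simp
  qed
qed

section \<open>Zeros of the transform and the pseudo-inverse\<close>

lemma psi_zero_imp:
  assumes "psi z = 0" "0 \<le> z"
  shows "emeasure \<gamma> {t \<in> space \<gamma>. t * z < 1} = 0"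
proof -
  have "AE t in \<gamma>. kern z t = 0"
    using assms(1) unfolding psi_def
    by (subst (asm) integral_nonneg_eq_0_iff_AE) (auto simp: kern_bounds space_gamma)
  then have "AE t in \<gamma>. \<not> t * z < 1"
    by eventually_elim (use assms(2) n_pos in \<open>auto simp: kern_def max_def split: if_splits\<close>)
  then show ?thesis by (subst (asm) AE_iff_measurable[OF _ refl]) auto
qed

text \<open>Excludes an atom of the conditional law at \<open>0\<close>. With
  \<open>z = 1 / t - s\<close> and \<open>psi z = 0\<close>, \<open>\<gamma>\<close> has no mass
  below \<open>1 / z\<close>, while \<open>t = 1 / (z + s)\<close> lies strictly below
  \<open>1 / z\<close> because \<open>s > 0\<close>. A rational \<open>r\<close> in between puts
  \<open>t\<close> into one of countably many null rays.\<close>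

lemma psi_zero_null:
  assumes "0 < s"
  shows "{t \<in> space \<gamma>. 0 < t \<and> t * s \<le> 1 \<and> psi (1 / t - s) = 0} \<in> null_sets \<gamma>" (is "?Z \<in> _")
proof -
  let ?R = "{r \<in> \<rat>. emeasure \<gamma> {t \<in> space \<gamma>. t < r} = 0}"
  have "(\<Union>r\<in>?R. {t \<in> space \<gamma>. t < r}) \<in> null_sets \<gamma>"
  proof (rule null_sets_UN')
    show "countable ?R" by (rule countable_subset[OF _ countable_rat]) auto
  qed auto
  moreover have "?Z \<subseteq> (\<Union>r\<in>?R. {t \<in> space \<gamma>. t < r})"
  proof
    fix t assume "t \<in> ?Z"
    then have t: "t \<in> space \<gamma>" "0 < t" "t * s \<le> 1" "psi (1 / t - s) = 0" by auto
    define z where "z = 1 / t - s"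
    have z: "0 < z"
      using t psi_nonpos_arg[of z] by (cases "0 < z") (auto simp: z_def)
    have "t < 1 / z"
      using t z assms by (simp add: z_def field_simps)
    then obtain r where r: "r \<in> \<rat>" "t < r" "r < 1 / z" using Rats_dense_in_real by blast
    have "emeasure \<gamma> {t \<in> space \<gamma>. t < r} \<le> emeasure \<gamma> {t \<in> space \<gamma>. t * z < 1}"
    proof (rule emeasure_mono)
      show "{t \<in> space \<gamma>. t < r} \<subseteq> {t \<in> space \<gamma>. t * z < 1}"
      proof clarsimp
        fix t assume "t < r"
        then have "t < 1 / z" using r by simp
        then show "t * z < 1" using z by (simp add: pos_less_divide_eq)
      qed
    qed measurable
    also have "\<dots> = 0" using t z by (intro psi_zero_imp) (auto simp: z_def)
    finally show "t \<in> (\<Union>r\<in>?R. {t \<in> space \<gamma>. t < r})" using r t by auto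
  qed
  moreover have "?Z \<in> sets \<gamma>" by measurable
  ultimately show ?thesis by (blast intro: null_sets_subset)
qed

lemma ext_gen_eq: "ext_gen (williamson_generator (Suc n) \<gamma>) z = (if z = \<infinity> then 0 else psi (enn2real z))"
  by (simp add: ext_gen_def psi_eq)

text \<open>A Galois connection, valid even where the infimum is infinite; it turns the inequalities
  of a corner into lower bounds on arguments of \<open>psi\<close>. In the second direction
  continuity keeps \<open>psi\<close> above \<open>y\<close> slightly beyond \<open>x\<close>, so
  the infimum would exceed \<open>x\<close> strictly.\<close>

lemma psi_le_iff:
  assumes "0 \<le> y" "y \<le> 1" "0 \<le> x"
  shows "psi x \<le> y \<longleftrightarrow> pseudo_inverse (williamson_generator (Suc n) \<gamma>) y \<le> ennreal x"
proof
  assume le: "psi x \<le> y"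
  have "\<exists>z\<ge>0. z \<le> x \<and> psi z = y"
    using le assms psi_nonpos_arg[of 0] psi_continuous by (intro IVT2) auto
  then obtain z where "0 \<le> z" "z \<le> x" "psi z = y" by blast
  then have "pseudo_inverse (williamson_generator (Suc n) \<gamma>) y \<le> ennreal z"
    unfolding pseudo_inverse_def by (intro Inf_lower) (auto simp: ext_gen_eq)
  also have "\<dots> \<le> ennreal x" using \<open>z \<le> x\<close> by (rule ennreal_leI)
  finally show "pseudo_inverse (williamson_generator (Suc n) \<gamma>) y \<le> ennreal x" .
next
  assume le: "pseudo_inverse (williamson_generator (Suc n) \<gamma>) y \<le> ennreal x"
  show "psi x \<le> y"
  proof (rule ccontr)
    assume "\<not> psi x \<le> y"
    then have "y < psi x" by simp
    have "(psi \<longlongrightarrow> psi x) (at x)" using psi_continuous by (simp add: isCont_def)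
    then have "eventually (\<lambda>w. y < psi w) (at x)" using \<open>y < psi x\<close> by (rule order_tendstoD)
    then obtain d where d: "0 < d" "\<And>w. w \<noteq> x \<Longrightarrow> dist w x < d \<Longrightarrow> y < psi w"
      by (auto simp: eventually_at)
    have gt: "y < psi (x + d / 2)" using d by (auto simp: dist_real_def)
    have "ennreal (x + d / 2) \<le> pseudo_inverse (williamson_generator (Suc n) \<gamma>) y"
      unfolding pseudo_inverse_def
    proof (rule Inf_greatest)
      fix z assume "z \<in> {z. ext_gen (williamson_generator (Suc n) \<gamma>) z = y}"
      then have z: "ext_gen (williamson_generator (Suc n) \<gamma>) z = y" by simp
      show "ennreal (x + d / 2) \<le> z"
      proof (cases z)
        case (real r)
        then have "psi r = y" using z by (simp add: ext_gen_eq)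
        then have "x + d / 2 \<le> r" using gt psi_antimono[of r "x + d / 2"] by (cases "x + d / 2 \<le> r") auto
        then show ?thesis using real by (simp add: ennreal_leI)
      qed simp
    qed
    with le have "ennreal (x + d / 2) \<le> ennreal x" by (rule order_trans[rotated])
    then show False using d assms by (simp add: ennreal_le_iff)
  qed
qed

section \<open>The copula as an image measure\<close>

abbreviation leb :: "(nat \<Rightarrow> real) measure" where
  "leb \<equiv> Pi\<^sub>M {..<n} (\<lambda>_. lborel)"

definition nonneg_vec :: "(nat \<Rightarrow> real) \<Rightarrow> bool" where
  "nonneg_vec x \<longleftrightarrow> (\<forall>i\<in>{..<n}. 0 \<le> x i)"

text \<open>\<open>fact n * t ^ n\<close> is the reciprocal of the volume of the simplex \<open>{x \<ge> 0. t * \<Sum>x < 1}\<close>.\<close>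

definition dens :: "real \<Rightarrow> real \<Rightarrow> ennreal" where
  "dens s t = (if t * s < 1 then ennreal (fact n * t ^ n) else 0)"

definition psi_vec :: "(nat \<Rightarrow> real) \<Rightarrow> nat \<Rightarrow> real" where
  "psi_vec x = (\<lambda>i\<in>{..<n}. psi (x i))"

definition joint_map :: "(nat \<Rightarrow> real) \<times> real \<Rightarrow> nat \<Rightarrow> real" where
  "joint_map = (\<lambda>(x, t). \<lambda>i\<in>{..<Suc n}. if i < n then psi (x i) else psi (1 / t - (\<Sum>i<n. x i)))"

definition joint :: "real measure \<Rightarrow> ((nat \<Rightarrow> real) \<times> real) measure" where
  "joint T = density (leb \<Otimes>\<^sub>M T) (\<lambda>(x, t). if nonneg_vec x then dens (\<Sum>i<n. x i) t else 0)"

definition copula_of :: "real measure \<Rightarrow> (nat \<Rightarrow> real) measure" where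
  "copula_of T = distr (joint T) (cube (Suc n)) joint_map"

text \<open>The measures to be inserted for \<open>T\<close> are the parts of
  \<open>\<gamma>\<close>. Domination makes them finite and keeps null sets of
  \<open>\<gamma>\<close> null.\<close>

definition dominated :: "real measure \<Rightarrow> bool" where
  "dominated T \<longleftrightarrow> sets T = sets \<gamma> \<and> (\<forall>B\<in>sets \<gamma>. emeasure T B \<le> emeasure \<gamma> B)"

text \<open>For \<open>s > 0\<close> this is, up to the sign \<open>(-1) ^ n\<close>, the
  \<open>n\<close>-th derivative of \<open>psi\<close> at \<open>s\<close> where it exists. It is
  also the density of \<open>x\<close> at a point of coordinate sum \<open>s\<close> once
  \<open>t\<close> has been integrated out.\<close>

definition total_dens :: "real \<Rightarrow> ennreal" where
  "total_dens s = (\<integral>\<^sup>+t. dens s t \<partial>\<gamma>)"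

definition marginal :: "(nat \<Rightarrow> real) measure" where
  "marginal = distr (density leb (\<lambda>x. if nonneg_vec x then total_dens (\<Sum>i<n. x i) else 0)) (cube n) psi_vec"

text \<open>Recovers, where \<open>psi\<close> can be inverted, the sum \<open>s\<close>, the only
  quantity on which the conditional law depends.\<close>

definition psi_inv_sum :: "(nat \<Rightarrow> real) \<Rightarrow> real" where
  "psi_inv_sum y = (\<Sum>i<n. psi_inv (y i))"

text \<open>Division is by the constant of \<open>\<gamma>\<close> even if \<open>T\<close> is just
  a part of it, so that the kernels of the parts add up to the kernel of
  \<open>\<gamma>\<close>.\<close>

definition kernel :: "real measure \<Rightarrow> real \<Rightarrow> real measure" where
  "kernel T s = distr (density T (\<lambda>t. dens s t / total_dens s)) unit_interval (\<lambda>t. psi (1 / t - s))"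

lemma dominated_self: "dominated \<gamma>"
  by (simp add: dominated_def)

lemma dominatedD:
  assumes "dominated T"
  shows dominated_sets: "sets T = sets \<gamma>"
    and dominated_space: "space T = {0..}"
    and dominated_finite: "finite_measure T"
    and dominated_measurable: "(\<lambda>t. t) \<in> borel_measurable T"
    and dominated_AE: "AE t in T. 0 < t"
    and dominated_null: "N \<in> null_sets \<gamma> \<Longrightarrow> N \<in> null_sets T"
proof -
  show s: "sets T = sets \<gamma>" using assms by (simp add: dominated_def)
  then show sp: "space T = {0..}" using space_gamma sets_eq_imp_space_eq by blast
  have "emeasure T (space T) \<le> emeasure \<gamma> (space T)"
    using assms s sp space_gamma sets.top[of \<gamma>] by (simp add: dominated_def)
  also have "\<dots> < \<infinity>" using emeasure_finite[of "space T"] by (simp add: less_top[symmetric])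
  finally show "finite_measure T" by (intro finite_measureI) auto
  show "(\<lambda>t. t) \<in> borel_measurable T"
    unfolding measurable_cong_sets[OF s refl] by (rule measurable_id_gamma)
  show null: "N \<in> null_sets T" if "N \<in> null_sets \<gamma>" for N
  proof -
    have "emeasure T N \<le> emeasure \<gamma> N" using assms that by (auto simp: dominated_def)
    then show ?thesis using that s by (auto simp: null_sets_def)
  qed
  have "{0} \<in> null_sets \<gamma>"
    by (auto simp: gamma_zero sets_gamma sets_restrict_space_iff null_sets_def)
  from null[OF this] show "AE t in T. 0 < t"
    by (rule AE_I') (auto simp: sp)
qed

section \<open>Rectangle masses and disintegration of the image measure\<close>

lemma dens_measurable [measurable (raw)]:
  assumes [measurable]: "f \<in> borel_measurable M" "g \<in> borel_measurable M"
  shows "(\<lambda>x. dens (f x) (g x)) \<in> borel_measurable M"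
  unfolding dens_def by measurable

lemma nonneg_vec_measurable [measurable]: "Measurable.pred leb nonneg_vec"
  unfolding nonneg_vec_def by measurable

lemma sum_measurable_leb [measurable]: "(\<lambda>x. \<Sum>i<n. x i) \<in> borel_measurable leb"
  by (rule borel_measurable_sum) measurable

lemma psi_unit: "psi z \<in> {0..1}"
  using psi_nonneg psi_le_one by auto

lemma psi_measurable_unit [measurable]: "psi \<in> borel \<rightarrow>\<^sub>M unit_interval"
  by (rule measurable_restrict_space2) (use psi_unit in \<open>auto simp: Pi_iff\<close>)

lemma psi_vec_measurable [measurable]: "psi_vec \<in> leb \<rightarrow>\<^sub>M cube n"
  unfolding psi_vec_def by measurable

lemma snd_measurable:
  assumes "(\<lambda>t. t) \<in> borel_measurable T"
  shows "(\<lambda>p. snd p) \<in> borel_measurable (M \<Otimes>\<^sub>M T)"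
  by (rule measurable_compose[OF measurable_snd assms])

lemma joint_map_measurable:
  assumes id: "(\<lambda>t. t) \<in> borel_measurable T"
  shows "joint_map \<in> leb \<Otimes>\<^sub>M T \<rightarrow>\<^sub>M cube (Suc n)"
  unfolding joint_map_def case_prod_beta
proof (rule measurable_restrict)
  fix i assume "i \<in> {..<Suc n}"
  note snd_measurable[OF id, measurable]
  show "(\<lambda>p. if i < n then psi (fst p i) else psi (1 / snd p - (\<Sum>i<n. fst p i))) \<in> leb \<Otimes>\<^sub>M T \<rightarrow>\<^sub>M unit_interval"
  proof (cases "i < n")
    case True
    then have "(\<lambda>x. x i) \<in> leb \<rightarrow>\<^sub>M lborel"
      by (intro measurable_component_singleton) simp
    from measurable_compose[OF measurable_fst this]
    have [measurable]: "(\<lambda>p. fst p i) \<in> borel_measurable (leb \<Otimes>\<^sub>M T)"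
      by simp
    show ?thesis using True by simp
  next
    case False
    then show ?thesis by simp
  qed
qed

lemma total_dens_measurable [measurable]: "total_dens \<in> borel_measurable borel"
proof -
  note snd_measurable[OF measurable_id_gamma, measurable]
  show ?thesis unfolding total_dens_def[abs_def] by measurable
qed

lemma joint_map_simps:
  "restrict (joint_map (x, t)) {..<n} = psi_vec x"
  "joint_map (x, t) n = psi (1 / t - (\<Sum>i<n. x i))"
  "i < n \<Longrightarrow> joint_map (x, t) i = psi (x i)"
  by (auto simp: joint_map_def psi_vec_def restrict_def fun_eq_iff)

lemma joint_dens_measurable:
  assumes id: "(\<lambda>t. t) \<in> borel_measurable T"
  shows "(\<lambda>(x, t). if nonneg_vec x then dens (\<Sum>i<n. x i) t else 0) \<in> borel_measurable (leb \<Otimes>\<^sub>M T)"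
proof -
  note snd_measurable[OF id, measurable]
  show ?thesis
    unfolding case_prod_beta by measurable
qed

lemma emeasure_copula_of:
  assumes T: "dominated T" and Z: "Z \<in> sets (cube (Suc n))"
  shows "emeasure (copula_of T) Z =
    (\<integral>\<^sup>+p. (case p of (x, t) \<Rightarrow> if nonneg_vec x then dens (\<Sum>i<n. x i) t else 0) * indicator Z (joint_map p)
      \<partial>(leb \<Otimes>\<^sub>M T))"
proof -
  note id = dominated_measurable[OF T]
  have jm: "joint_map \<in> joint T \<rightarrow>\<^sub>M cube (Suc n)"
    using joint_map_measurable[OF id] by (simp add: joint_def)
  have "emeasure (copula_of T) Z = emeasure (joint T) (joint_map -` Z \<inter> space (joint T))"
    unfolding copula_of_def by (rule emeasure_distr[OF jm Z])
  also have "\<dots> = (\<integral>\<^sup>+p. (case p of (x, t) \<Rightarrow> if nonneg_vec x then dens (\<Sum>i<n. x i) t else 0) *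
      indicator (joint_map -` Z \<inter> space (joint T)) p \<partial>(leb \<Otimes>\<^sub>M T))"
    unfolding joint_def
    by (rule emeasure_density[OF joint_dens_measurable[OF id]])
       (use measurable_sets[OF jm Z] in \<open>simp add: joint_def\<close>)
  also have "\<dots> = (\<integral>\<^sup>+p. (case p of (x, t) \<Rightarrow> if nonneg_vec x then dens (\<Sum>i<n. x i) t else 0) * indicator Z (joint_map p)
      \<partial>(leb \<Otimes>\<^sub>M T))"
    by (intro nn_integral_cong) (auto simp: joint_def indicator_def)
  finally show ?thesis .
qed

lemma rect_sets:
  assumes "E \<in> sets (cube n)" "F \<in> sets unit_interval"
  shows "{z \<in> space (cube (Suc n)). restrict z {..<n} \<in> E \<and> z n \<in> F} \<in> sets (cube (Suc n))"
proof -
  have "(\<lambda>z. restrict z {..<n}) \<in> cube (Suc n) \<rightarrow>\<^sub>M cube n"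
    by (rule measurable_restrict_subset) auto
  moreover have "(\<lambda>z. z n) \<in> cube (Suc n) \<rightarrow>\<^sub>M unit_interval"
    by (rule measurable_component_singleton) simp
  ultimately have "((\<lambda>z. restrict z {..<n}) -` E \<inter> space (cube (Suc n))) \<inter> ((\<lambda>z. z n) -` F \<inter> space (cube (Suc n)))
      \<in> sets (cube (Suc n))"
    using assms by (intro sets.Int measurable_sets)
  also have "((\<lambda>z. restrict z {..<n}) -` E \<inter> space (cube (Suc n))) \<inter> ((\<lambda>z. z n) -` F \<inter> space (cube (Suc n)))
      = {z \<in> space (cube (Suc n)). restrict z {..<n} \<in> E \<and> z n \<in> F}"
    by blast
  finally show ?thesis .
qed

lemma unit_interval_borel: "F \<in> sets unit_interval \<Longrightarrow> F \<in> sets borel"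
  by (auto simp: sets_restrict_space_iff)

text \<open>Fubini with \<open>t\<close> innermost exhibits the kernel; the corner formula further
  down integrates in the opposite order.\<close>

lemma emeasure_copula_of_rect:
  assumes T: "dominated T" and E: "E \<in> sets (cube n)" and F: "F \<in> sets unit_interval"
  shows "emeasure (copula_of T) {z \<in> space (cube (Suc n)). restrict z {..<n} \<in> E \<and> z n \<in> F} =
    (\<integral>\<^sup>+x. (if nonneg_vec x then \<integral>\<^sup>+t. dens (\<Sum>i<n. x i) t * indicator F (psi (1 / t - (\<Sum>i<n. x i))) \<partial>T else 0)
      * indicator E (psi_vec x) \<partial>leb)" (is "emeasure _ ?Z = _")
proof -
  interpret T: finite_measure T by (rule dominated_finite[OF T])
  note id[measurable (raw)] = dominated_measurable[OF T]
  note [measurable] = unit_interval_borel[OF F]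
  have Z: "?Z \<in> sets (cube (Suc n))" by (rule rect_sets[OF E F])
  have "emeasure (copula_of T) ?Z =
    (\<integral>\<^sup>+p. (case p of (x, t) \<Rightarrow> if nonneg_vec x then dens (\<Sum>i<n. x i) t else 0) * indicator ?Z (joint_map p)
      \<partial>(leb \<Otimes>\<^sub>M T))"
    by (rule emeasure_copula_of[OF T Z])
  also have "\<dots> = (\<integral>\<^sup>+x. \<integral>\<^sup>+t. (case (x, t) of (x, t) \<Rightarrow> if nonneg_vec x then dens (\<Sum>i<n. x i) t else 0)
      * indicator ?Z (joint_map (x, t)) \<partial>T \<partial>leb)"
    by (rule T.nn_integral_fst[symmetric])
       (intro borel_measurable_times_ennreal joint_dens_measurable[OF id]
         measurable_compose[OF joint_map_measurable[OF id]] borel_measurable_indicator Z)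
  also have "\<dots> = (\<integral>\<^sup>+x. (if nonneg_vec x then \<integral>\<^sup>+t. dens (\<Sum>i<n. x i) t * indicator F (psi (1 / t - (\<Sum>i<n. x i))) \<partial>T else 0)
      * indicator E (psi_vec x) \<partial>leb)"
  proof (intro nn_integral_cong)
    fix x assume x: "x \<in> space leb"
    have "joint_map (x, t) \<in> space (cube (Suc n))" if "t \<in> space T" for t
      using measurable_space[OF joint_map_measurable[OF id], of "(x, t)"] x that by (simp add: space_pair_measure)
    then have "(\<integral>\<^sup>+t. (case (x, t) of (x, t) \<Rightarrow> if nonneg_vec x then dens (\<Sum>i<n. x i) t else 0)
        * indicator ?Z (joint_map (x, t)) \<partial>T) =
      (\<integral>\<^sup>+t. (if nonneg_vec x then dens (\<Sum>i<n. x i) t * indicator F (psi (1 / t - (\<Sum>i<n. x i))) else 0)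
        * indicator E (psi_vec x) \<partial>T)"
      by (intro nn_integral_cong) (simp add: joint_map_simps indicator_def)
    also have "\<dots> = (\<integral>\<^sup>+t. (if nonneg_vec x then dens (\<Sum>i<n. x i) t * indicator F (psi (1 / t - (\<Sum>i<n. x i))) else 0) \<partial>T)
        * indicator E (psi_vec x)"
      by (rule nn_integral_multc) measurable
    finally show "(\<integral>\<^sup>+t. (case (x, t) of (x, t) \<Rightarrow> if nonneg_vec x then dens (\<Sum>i<n. x i) t else 0)
        * indicator ?Z (joint_map (x, t)) \<partial>T) =
       (if nonneg_vec x then \<integral>\<^sup>+t. dens (\<Sum>i<n. x i) t * indicator F (psi (1 / t - (\<Sum>i<n. x i))) \<partial>T else 0)
      * indicator E (psi_vec x)"
      by (cases "nonneg_vec x") auto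
  qed
  finally show ?thesis .
qed

lemma emeasure_kernel:
  assumes T: "dominated T" and F: "F \<in> sets unit_interval"
  shows "emeasure (kernel T s) F = (\<integral>\<^sup>+t. dens s t / total_dens s * indicator F (psi (1 / t - s)) \<partial>T)"
proof -
  note id[measurable (raw)] = dominated_measurable[OF T]
  have m: "(\<lambda>t. psi (1 / t - s)) \<in> density T (\<lambda>t. dens s t / total_dens s) \<rightarrow>\<^sub>M unit_interval"
    unfolding measurable_density_eq1 by measurable
  have "emeasure (kernel T s) F = emeasure (density T (\<lambda>t. dens s t / total_dens s))
      ((\<lambda>t. psi (1 / t - s)) -` F \<inter> space T)"
    unfolding kernel_def by (subst emeasure_distr[OF m F]) simp
  also have "\<dots> = (\<integral>\<^sup>+t. dens s t / total_dens s * indicator ((\<lambda>t. psi (1 / t - s)) -` F \<inter> space T) t \<partial>T)"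
    by (rule emeasure_density) (use measurable_sets[OF m F] in \<open>auto\<close>)
  also have "\<dots> = (\<integral>\<^sup>+t. dens s t / total_dens s * indicator F (psi (1 / t - s)) \<partial>T)"
    by (intro nn_integral_cong) (auto simp: indicator_def)
  finally show ?thesis .
qed

lemma psi_inv_sum_measurable [measurable]: "psi_inv_sum \<in> borel_measurable (cube n)"
  unfolding psi_inv_sum_def[abs_def]
proof (rule borel_measurable_sum)
  fix i assume "i \<in> {..<n}"
  then have "(\<lambda>y. y i) \<in> cube n \<rightarrow>\<^sub>M unit_interval" by (rule measurable_component_singleton)
  then have "(\<lambda>y. y i) \<in> borel_measurable (cube n)" by (simp add: measurable_restrict_space2_iff)
  then show "(\<lambda>y. psi_inv (y i)) \<in> borel_measurable (cube n)" by measurable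
qed

lemma emeasure_kernel_measurable:
  assumes T: "dominated T" and F: "F \<in> sets unit_interval"
  shows "(\<lambda>s. emeasure (kernel T s) F) \<in> borel_measurable borel"
proof -
  interpret T: finite_measure T by (rule dominated_finite[OF T])
  note id[measurable (raw)] = dominated_measurable[OF T]
  note [measurable] = unit_interval_borel[OF F]
  note snd_measurable[OF id, measurable]
  show ?thesis
    unfolding emeasure_kernel[OF T F] by measurable
qed

lemma dominated_AE_transfer:
  assumes "dominated T" "AE t in \<gamma>. P t"
  shows "AE t in T. P t"
proof -
  obtain N where N: "{t \<in> space \<gamma>. \<not> P t} \<subseteq> N" "N \<in> null_sets \<gamma>"
    using assms(2) by (auto elim!: AE_E)
  show ?thesis
    by (rule AE_I'[OF dominated_null[OF assms(1) N(2)]])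
       (use N(1) in \<open>simp add: dominated_space[OF assms(1)] space_gamma\<close>)
qed

text \<open>On \<open>t * s < 1\<close> one has \<open>t \<le> 1 / s\<close>. At
  \<open>s = 0\<close> the constant is \<open>fact n\<close> times the \<open>n\<close>-th moment of
  \<open>\<gamma>\<close>, which may be infinite.\<close>

lemma total_dens_finite:
  assumes "0 < s"
  shows "total_dens s < \<infinity>"
proof -
  have "total_dens s \<le> (\<integral>\<^sup>+t. ennreal (fact n * (1 / s) ^ n) \<partial>\<gamma>)"
    unfolding total_dens_def
  proof (rule nn_integral_mono)
    fix t assume "t \<in> space \<gamma>"
    then have "0 \<le> t" by (simp add: space_gamma)
    show "dens s t \<le> ennreal (fact n * (1 / s) ^ n)"
    proof (cases "t * s < 1")
      case True
      then have "t \<le> 1 / s" using assms by (simp add: field_simps)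
      with \<open>0 \<le> t\<close> show ?thesis
        using True unfolding dens_def by (auto intro!: ennreal_leI mult_left_mono power_mono)
    qed (simp add: dens_def)
  qed
  also have "\<dots> < \<infinity>" by (simp add: emeasure_space_1 ennreal_mult_less_top)
  finally show ?thesis .
qed

text \<open>If \<open>psi s = 0\<close>, then \<open>\<gamma>\<close> gives no mass to
  \<open>t * s < 1\<close>, outside of which \<open>dens s\<close> vanishes. Consequently
  \<open>psi\<close> can be inverted at every nonnegative sum where the marginal density is
  nonzero.\<close>

lemma psi_pos_of_total_dens:
  assumes "0 \<le> s" "total_dens s \<noteq> 0"
  shows "0 < psi s"
proof (rule ccontr)
  assume "\<not> 0 < psi s"
  then have "psi s = 0" using psi_nonneg[of s] by simp
  then have "emeasure \<gamma> {t \<in> space \<gamma>. t * s < 1} = 0" using assms(1) by (rule psi_zero_imp)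
  moreover have "{t \<in> space \<gamma>. t * s < 1} \<in> sets \<gamma>" by measurable
  ultimately have "{t \<in> space \<gamma>. t * s < 1} \<in> null_sets \<gamma>" by auto
  then have "AE t in \<gamma>. dens s t = 0"
    by (rule AE_I') (auto simp: dens_def)
  then have "total_dens s = 0"
    unfolding total_dens_def by (subst nn_integral_0_iff_AE) auto
  with assms show False by simp
qed

text \<open>Undoes the normalisation. If the constant is \<open>0\<close>, then
  \<open>dens s\<close> vanishes almost everywhere for \<open>\<gamma>\<close>, hence for
  \<open>T\<close>, and both sides are \<open>0\<close>.\<close>

lemma total_dens_times_kernel:
  assumes T: "dominated T" and F: "F \<in> sets unit_interval" and s: "0 < s"
  shows "total_dens s * emeasure (kernel T s) F = (\<integral>\<^sup>+t. dens s t * indicator F (psi (1 / t - s)) \<partial>T)"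
proof (cases "total_dens s = 0")
  case True
  then have "AE t in \<gamma>. dens s t = 0"
    unfolding total_dens_def by (subst (asm) nn_integral_0_iff_AE) auto
  from dominated_AE_transfer[OF T this]
  have "AE t in T. dens s t * indicator F (psi (1 / t - s)) = 0"
    by eventually_elim simp
  then have "(\<integral>\<^sup>+t. dens s t * indicator F (psi (1 / t - s)) \<partial>T) = (\<integral>\<^sup>+t. 0 \<partial>T)"
    by (rule nn_integral_cong_AE)
  then show ?thesis using True by simp
next
  case False
  note dominated_measurable[OF T, measurable (raw)]
  note [measurable] = unit_interval_borel[OF F]
  have fin: "total_dens s \<noteq> \<infinity>" using total_dens_finite[OF s] by simp
  have "total_dens s * emeasure (kernel T s) F =
      (\<integral>\<^sup>+t. total_dens s * (dens s t / total_dens s * indicator F (psi (1 / t - s))) \<partial>T)"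
    unfolding emeasure_kernel[OF T F] by (rule nn_integral_cmult[symmetric]) measurable
  also have "\<dots> = (\<integral>\<^sup>+t. dens s t * indicator F (psi (1 / t - s)) \<partial>T)"
    using False fin
    by (intro nn_integral_cong) (simp add: mult.assoc[symmetric] ennreal_times_divide ennreal_mult_divide_eq mult.commute[of "total_dens s"])
  finally show ?thesis .
qed

text \<open>No coordinate exceeds the sum, so positivity of \<open>psi\<close> at the sum makes
  every coordinate recoverable.\<close>

lemma psi_inv_sum_psi_vec:
  assumes "nonneg_vec x" "0 < psi (\<Sum>i<n. x i)"
  shows "psi_inv_sum (psi_vec x) = (\<Sum>i<n. x i)"
  unfolding psi_inv_sum_def psi_vec_def
proof (intro sum.cong refl)
  fix i assume i: "i \<in> {..<n}"
  have "x i \<le> (\<Sum>i<n. x i)"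
    using assms(1) i by (intro member_le_sum) (auto simp: nonneg_vec_def)
  then have "psi (\<Sum>i<n. x i) \<le> psi (x i)" by (rule psi_antimono)
  then have "0 < psi (x i)" using assms(2) by linarith
  then show "psi_inv (restrict (\<lambda>i. psi (x i)) {..<n} i) = x i"
    using i assms(1) psi_inv_psi[of "x i"] by (simp add: nonneg_vec_def)
qed

lemma nn_integral_marginal:
  assumes f: "f \<in> borel_measurable (cube n)"
  shows "(\<integral>\<^sup>+y. f y \<partial>marginal) = (\<integral>\<^sup>+x. (if nonneg_vec x then total_dens (\<Sum>i<n. x i) else 0) * f (psi_vec x) \<partial>leb)"
proof -
  have "(\<integral>\<^sup>+y. f y \<partial>marginal) = (\<integral>\<^sup>+x. f (psi_vec x)
      \<partial>(density leb (\<lambda>x. if nonneg_vec x then total_dens (\<Sum>i<n. x i) else 0)))"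
    unfolding marginal_def by (rule nn_integral_distr) (use f in auto)
  also have "\<dots> = (\<integral>\<^sup>+x. (if nonneg_vec x then total_dens (\<Sum>i<n. x i) else 0) * f (psi_vec x) \<partial>leb)"
    by (rule nn_integral_density) (use measurable_compose[OF psi_vec_measurable f] in auto)
  finally show ?thesis .
qed

lemma AE_sum_leb: "AE x in leb. (\<Sum>i<n. x i) \<noteq> c"
  using n_pos by (intro AE_sum_neq) auto

text \<open>Supplies the condition \<open>0 < s\<close> under which the kernels are decomposed. The
  exceptional \<open>x\<close> lie on the hyperplane of sum \<open>0\<close> or where the marginal
  density vanishes.\<close>

lemma AE_psi_inv_sum_pos: "AE y in marginal. 0 < psi_inv_sum y"
proof -
  let ?d = "\<lambda>x. if nonneg_vec x then total_dens (\<Sum>i<n. x i) else 0"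
  have "AE x in leb. 0 < ?d x \<longrightarrow> 0 < psi_inv_sum (psi_vec x)"
    using AE_sum_leb[of 0]
  proof eventually_elim
    case (elim x)
    show ?case
    proof
      assume "0 < ?d x"
      then have x: "nonneg_vec x" "total_dens (\<Sum>i<n. x i) \<noteq> 0" by (auto split: if_splits)
      have "0 \<le> (\<Sum>i<n. x i)" using x(1) by (intro sum_nonneg) (auto simp: nonneg_vec_def)
      with elim have s: "0 < (\<Sum>i<n. x i)" by simp
      have "0 < psi (\<Sum>i<n. x i)" using s x(2) by (intro psi_pos_of_total_dens) auto
      with psi_inv_sum_psi_vec[OF x(1) this] s show "0 < psi_inv_sum (psi_vec x)" by simp
    qed
  qed
  then have "AE x in density leb ?d. 0 < psi_inv_sum (psi_vec x)"
    by (subst AE_density) auto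
  moreover have "{y \<in> space (cube n). 0 < psi_inv_sum y} \<in> sets (cube n)"
    by measurable
  ultimately show ?thesis
    unfolding marginal_def by (subst AE_distr_iff) auto
qed

text \<open>Pulled back to \<open>x\<close>, the factor \<open>total_dens\<close> in the marginal
  density cancels the normalisation of the kernel.\<close>

lemma disintegrates_copula_of:
  assumes T: "dominated T"
  shows "disintegrates (Suc n) (copula_of T) marginal (\<lambda>y. kernel T (psi_inv_sum y))"
  unfolding disintegrates_def diff_Suc_1
proof (intro conjI ballI)
  show "sets (copula_of T) = sets (cube (Suc n))" by (simp add: copula_of_def)
  fix E F assume E: "E \<in> sets (cube n)" and F: "F \<in> sets unit_interval"
  have m: "(\<lambda>y. emeasure (kernel T (psi_inv_sum y)) F) \<in> borel_measurable (cube n)"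
    by (rule measurable_compose[OF psi_inv_sum_measurable emeasure_kernel_measurable[OF T F]])
  have "(\<integral>\<^sup>+y\<in>E. emeasure (kernel T (psi_inv_sum y)) F \<partial>marginal) =
    (\<integral>\<^sup>+x. (if nonneg_vec x then total_dens (\<Sum>i<n. x i) else 0) *
      (emeasure (kernel T (psi_inv_sum (psi_vec x))) F * indicator E (psi_vec x)) \<partial>leb)"
    by (rule nn_integral_marginal) (intro borel_measurable_times_ennreal m borel_measurable_indicator E)
  also have "\<dots> = (\<integral>\<^sup>+x. (if nonneg_vec x then \<integral>\<^sup>+t. dens (\<Sum>i<n. x i) t * indicator F (psi (1 / t - (\<Sum>i<n. x i))) \<partial>T else 0)
      * indicator E (psi_vec x) \<partial>leb)"
  proof (rule nn_integral_cong_AE)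
    show "AE x in leb. (if nonneg_vec x then total_dens (\<Sum>i<n. x i) else 0) *
      (emeasure (kernel T (psi_inv_sum (psi_vec x))) F * indicator E (psi_vec x)) =
      (if nonneg_vec x then \<integral>\<^sup>+t. dens (\<Sum>i<n. x i) t * indicator F (psi (1 / t - (\<Sum>i<n. x i))) \<partial>T else 0)
      * indicator E (psi_vec x)"
      using AE_sum_leb[of 0]
    proof eventually_elim
      case (elim x)
      show ?case
      proof (cases "nonneg_vec x")
        case True
        let ?s = "\<Sum>i<n. x i"
        have "0 \<le> ?s" using True by (intro sum_nonneg) (auto simp: nonneg_vec_def)
        with elim have s: "0 < ?s" by simp
        \<comment> \<open>The sum need not be recoverable where the marginal density is
          \<open>0\<close>, but there both products vanish.\<close>
        have "total_dens ?s * emeasure (kernel T (psi_inv_sum (psi_vec x))) F = total_dens ?s * emeasure (kernel T ?s) F"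
        proof (cases "total_dens ?s = 0")
          case False
          then have "0 < psi ?s" using s by (intro psi_pos_of_total_dens) auto
          then show ?thesis using psi_inv_sum_psi_vec[OF True] by simp
        qed simp
        then show ?thesis
          using True total_dens_times_kernel[OF T F s] by (simp add: mult.assoc[symmetric])
      qed simp
    qed
  qed
  finally show "emeasure (copula_of T) {x \<in> space (cube (Suc n)). restrict x {..<n} \<in> E \<and> x n \<in> F} =
      (\<integral>\<^sup>+y\<in>E. emeasure (kernel T (psi_inv_sum y)) F \<partial>marginal)"
    unfolding emeasure_copula_of_rect[OF T E F] by simp
qed

text \<open>For fixed \<open>t\<close> the corner cuts out the simplex with lower bounds
  \<open>b i\<close> and coordinate sum at most \<open>1 / t - b n\<close>. With \<open>c\<close>
  the sum of all \<open>n + 1\<close> bounds its volume is \<open>(1 / t - c) ^ n / fact n\<close>;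
  multiplied by \<open>fact n * t ^ n\<close> this is \<open>(1 - t * c) ^ n\<close>, the integrand
  of the Williamson transform.\<close>

lemma emeasure_copula_of_corner:
  fixes u :: "nat \<Rightarrow> real"
  defines "a \<equiv> \<lambda>i. pseudo_inverse (williamson_generator (Suc n) \<gamma>) (u i)"
  assumes T: "dominated T" and u: "u \<in> space (cube (Suc n))"
  shows "emeasure (copula_of T) {z \<in> space (cube (Suc n)). \<forall>i<Suc n. z i \<le> u i} =
    (\<integral>\<^sup>+t. (if (\<Sum>i<Suc n. a i) = \<infinity> then 0 else ennreal (kern (enn2real (\<Sum>i<Suc n. a i)) t)) \<partial>T)"
    (is "emeasure _ ?Z = (\<integral>\<^sup>+t. ?k t \<partial>T)")
proof -
  interpret T: finite_measure T by (rule dominated_finite[OF T])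
  interpret P: product_sigma_finite "\<lambda>_::nat. lborel :: real measure" by standard
  interpret L: sigma_finite_measure leb by (rule P.sigma_finite) simp
  interpret LT: pair_sigma_finite leb T ..
  note id = dominated_measurable[OF T]
  have Z: "?Z \<in> sets (cube (Suc n))" by (rule corner_in_sets_cube)
  have u01: "0 \<le> u i" "u i \<le> 1" if "i < Suc n" for i
    using u that PiE_mem[of u "{..<Suc n}" "\<lambda>_. {0..1}" i] by (simp_all add: space_PiM space_restrict_space)
  have le_iff: "psi x \<le> u i \<longleftrightarrow> a i \<le> ennreal x" if "i < Suc n" "0 \<le> x" for i x
    unfolding a_def using u01[OF that(1)] that(2) by (intro psi_le_iff)
  let ?w = "\<lambda>x t. (if nonneg_vec x then dens (\<Sum>i<n. x i) t else 0) * indicator ?Z (joint_map (x, t))"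
  have in_Z: "joint_map (x, t) \<in> ?Z \<longleftrightarrow> (\<forall>i<n. a i \<le> ennreal (x i)) \<and> a n \<le> ennreal (1 / t - (\<Sum>i<n. x i))"
    if "x \<in> space leb" "t \<in> space T" "nonneg_vec x" "(\<Sum>i<n. x i) \<le> 1 / t" for x t
  proof -
    have sp: "joint_map (x, t) \<in> space (cube (Suc n))"
      using measurable_space[OF joint_map_measurable[OF id], of "(x, t)"] that by (simp add: space_pair_measure)
    have "joint_map (x, t) \<in> ?Z \<longleftrightarrow> (\<forall>i<Suc n. joint_map (x, t) i \<le> u i)"
      using sp by blast
    also have "\<dots> \<longleftrightarrow> (\<forall>i<n. joint_map (x, t) i \<le> u i) \<and> joint_map (x, t) n \<le> u n"
      by (auto simp: less_Suc_eq)
    also have "\<dots> \<longleftrightarrow> (\<forall>i<n. psi (x i) \<le> u i) \<and> psi (1 / t - (\<Sum>i<n. x i)) \<le> u n"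
      by (simp add: joint_map_simps)
    also have "\<dots> \<longleftrightarrow> (\<forall>i<n. a i \<le> ennreal (x i)) \<and> a n \<le> ennreal (1 / t - (\<Sum>i<n. x i))"
      using that(3,4) le_iff by (simp add: nonneg_vec_def)
    finally show ?thesis .
  qed
  have "emeasure (copula_of T) ?Z = (\<integral>\<^sup>+p. (case p of (x, t) \<Rightarrow> if nonneg_vec x then dens (\<Sum>i<n. x i) t else 0) * indicator ?Z (joint_map p)
      \<partial>(leb \<Otimes>\<^sub>M T))"
    by (rule emeasure_copula_of[OF T Z])
  also have "\<dots> = (\<integral>\<^sup>+t. \<integral>\<^sup>+x. (case (x, t) of (x, t) \<Rightarrow> if nonneg_vec x then dens (\<Sum>i<n. x i) t else 0) * indicator ?Z (joint_map (x, t))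
      \<partial>leb \<partial>T)"
    by (rule LT.nn_integral_snd[symmetric])
       (intro borel_measurable_times_ennreal joint_dens_measurable[OF id]
         measurable_compose[OF joint_map_measurable[OF id]] borel_measurable_indicator Z)
  also have "\<dots> = (\<integral>\<^sup>+t. \<integral>\<^sup>+x. ?w x t \<partial>leb \<partial>T)" by simp
  also have "\<dots> = (\<integral>\<^sup>+t. ?k t \<partial>T)"
  proof (rule nn_integral_cong_AE)
    show "AE t in T. (\<integral>\<^sup>+x. ?w x t \<partial>leb) = ?k t"
      using dominated_AE[OF T] AE_space[of T]
    proof eventually_elim
      case (elim t)
      have le: "(\<Sum>i<n. x i) < 1 / t \<longleftrightarrow> t * (\<Sum>i<n. x i) < 1" for x :: "nat \<Rightarrow> real"
        using elim by (simp add: field_simps)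
      show ?case
      \<comment> \<open>An infinite pseudo-inverse arises from \<open>u i = 0\<close> when
        \<open>psi\<close> has no zero; no finite coordinate then meets the bound.\<close>
      proof (cases "\<exists>i<Suc n. a i = \<infinity>")
        case True
        then obtain i where i: "i < Suc n" "a i = \<infinity>" by blast
        have "?w x t = 0" if x: "x \<in> space leb" for x
        proof (rule ccontr)
          assume nz: "?w x t \<noteq> 0"
          then have "nonneg_vec x" "(\<Sum>i<n. x i) \<le> 1 / t" "joint_map (x, t) \<in> ?Z"
            using le[of x] by (auto simp: dens_def indicator_def split: if_splits)
          then have "(\<forall>i<n. a i \<le> ennreal (x i)) \<and> a n \<le> ennreal (1 / t - (\<Sum>i<n. x i))"
            using in_Z[OF x elim(2)] by blast
          then show False using i by (auto simp: less_Suc_eq top_unique)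
        qed
        then have "(\<integral>\<^sup>+x. ?w x t \<partial>leb) = (\<integral>\<^sup>+x. 0 \<partial>leb)" by (rule nn_integral_cong)
        moreover have "(\<Sum>i<Suc n. a i) = \<infinity>"
          using i by (auto simp: ennreal_sum_eq_top simp del: sum.lessThan_Suc)
        ultimately show ?thesis by simp
      next
        case False
        define b where "b i = enn2real (a i)" for i
        have b: "a i = ennreal (b i)" "0 \<le> b i" if "i < Suc n" for i
          using False that by (auto simp: b_def less_top)
        let ?S = "{x \<in> space leb. (\<forall>i\<in>{..<n}. b i \<le> x i) \<and> (\<Sum>i<n. x i) \<le> 1 / t - b n}"
        have S: "?S \<in> sets leb" by measurable
        have bn: "0 \<le> b n" by (rule b) simp
        have "(\<integral>\<^sup>+x. ?w x t \<partial>leb) = (\<integral>\<^sup>+x. ennreal (fact n * t ^ n) * indicator ?S x \<partial>leb)"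
        proof (rule nn_integral_cong_AE)
          \<comment> \<open>Equality can fail on the face of coordinate sum \<open>1 / t\<close>:
            the density is \<open>0\<close> there, while \<open>?S\<close> may contain points of it
            when \<open>b n = 0\<close>.\<close>
          show "AE x in leb. ?w x t = ennreal (fact n * t ^ n) * indicator ?S x"
            using AE_sum_leb[of "1 / t"] AE_space[of leb]
          proof eventually_elim
            case x: (elim x)
            show ?case
            proof (cases "nonneg_vec x \<and> (\<Sum>i<n. x i) < 1 / t")
              case True
              then have "joint_map (x, t) \<in> ?Z \<longleftrightarrow>
                  (\<forall>i<n. a i \<le> ennreal (x i)) \<and> a n \<le> ennreal (1 / t - (\<Sum>i<n. x i))"
                using x(2) elim by (intro in_Z) auto
              also have "\<dots> \<longleftrightarrow> (\<forall>i<n. b i \<le> x i) \<and> b n \<le> 1 / t - (\<Sum>i<n. x i)"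
                using True b by (simp add: ennreal_le_iff nonneg_vec_def)
              also have "\<dots> \<longleftrightarrow> x \<in> ?S"
                using x(2) by (auto simp: le_diff_eq diff_le_eq add.commute)
              finally have "joint_map (x, t) \<in> ?Z \<longleftrightarrow> x \<in> ?S" .
              then have "indicator ?Z (joint_map (x, t)) = (indicator ?S x :: ennreal)"
                by (simp only: indicator_def)
              moreover have "(if nonneg_vec x then dens (\<Sum>i<n. x i) t else 0) = ennreal (fact n * t ^ n)"
                using True le[of x] by (simp add: dens_def)
              ultimately show ?thesis by (simp only:)
            next
              case F: False
              have "x \<notin> ?S"
              proof
                assume xS: "x \<in> ?S"
                then have bx: "\<forall>i\<in>{..<n}. b i \<le> x i" by blast
                have "0 \<le> x i" if "i < n" for i
                  using bx b(2)[of i] that by (meson lessThan_iff less_SucI order_trans)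
                then have "nonneg_vec x" by (simp add: nonneg_vec_def)
                moreover have "(\<Sum>i<n. x i) \<le> 1 / t"
                  using xS bn by auto
                ultimately show False using F x(1) by simp
              qed
              moreover have "(if nonneg_vec x then dens (\<Sum>i<n. x i) t else 0) = 0"
                using F le[of x] by (auto simp: dens_def)
              ultimately show ?thesis by (simp only: indicator_simps(2) not_False_eq_True mult_zero_left mult_zero_right)
            qed
          qed
        qed
        also have "\<dots> = ennreal (fact n * t ^ n) * emeasure leb ?S"
          by (rule nn_integral_cmult_indicator[OF S])
        also have "\<dots> = ennreal (kern (\<Sum>i<Suc n. b i) t)"
        proof -
          let ?c = "\<Sum>i<Suc n. b i"
          have c: "0 \<le> ?c" using b by (intro sum_nonneg) auto
          show ?thesis
          proof (cases "sum b {..<n} \<le> 1 / t - b n")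
            case True
            then have le1: "t * ?c \<le> 1" using elim by (simp add: field_simps)
            have "ennreal (fact n * t ^ n) * emeasure leb ?S
              = ennreal (fact n * t ^ n) * ennreal ((1 / t - b n - sum b {..<n}) ^ n / fact n)"
              using emeasure_shifted_simplex[OF _ True] by simp
            also have "\<dots> = ennreal (fact n * t ^ n * ((1 / t - b n - sum b {..<n}) ^ n / fact n))"
              using elim by (intro ennreal_mult'[symmetric]) simp
            also have "fact n * t ^ n * ((1 / t - b n - sum b {..<n}) ^ n / fact n) = (t * (1 / t - b n - sum b {..<n})) ^ n"
              by (simp add: power_mult_distrib)
            also have "t * (1 / t - b n - sum b {..<n}) = 1 - t * ?c"
              using elim by (simp add: field_simps)
            also have "(1 - t * ?c) ^ n = kern ?c t"
              using c le1 by (simp add: kern_def)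
            finally show ?thesis .
          next
            case F: False
            have "?S = {}"
            proof (rule ccontr)
              assume "?S \<noteq> {}"
              then obtain x where x: "x \<in> ?S" by blast
              then have "sum b {..<n} \<le> (\<Sum>i<n. x i)" by (intro sum_mono) auto
              with x F show False by auto
            qed
            moreover have "1 - t * ?c \<le> 0" using F elim by (simp add: field_simps)
            then have "kern ?c t = 0" using n_pos c by (simp add: kern_def max_absorb1)
            ultimately show ?thesis by (simp only: emeasure_empty mult_zero_right ennreal_0)
          qed
        qed
        also have "\<dots> = ?k t"
        proof -
          have "(\<Sum>i<Suc n. a i) = (\<Sum>i<Suc n. ennreal (b i))"
            using b by (intro sum.cong) auto
          also have "\<dots> = ennreal (\<Sum>i<Suc n. b i)"
            using b by (intro sum_ennreal) auto
          finally have eq: "(\<Sum>i<Suc n. a i) = ennreal (\<Sum>i<Suc n. b i)" .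
          have "0 \<le> (\<Sum>i<Suc n. b i)" using b by (intro sum_nonneg) auto
          then show ?thesis unfolding eq by simp
        qed
        finally show ?thesis .
      qed
    qed
  qed
  finally show ?thesis .
qed

section \<open>Total mass, distribution function and marginal\<close>

lemma pseudo_inverse_one: "pseudo_inverse (williamson_generator (Suc n) \<gamma>) 1 = 0"
  using psi_le_iff[of 1 0] psi_le_one[of 0] by simp

text \<open>The corner at all ones is the whole cube and corresponds to the argument
  \<open>0\<close>, where the integrand is \<open>1\<close>. Through this each component inherits
  the mass of its part of \<open>\<gamma>\<close>.\<close>

lemma emeasure_copula_of_space:
  assumes T: "dominated T"
  shows "emeasure (copula_of T) (space (cube (Suc n))) = emeasure T (space T)"
proof -
  let ?u = "\<lambda>i\<in>{..<Suc n}. 1 :: real"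
  have u: "?u \<in> space (cube (Suc n))" by (auto simp: space_PiM space_restrict_space)
  have le: "z i \<le> 1" if "z \<in> space (cube (Suc n))" "i < Suc n" for z i
    using that PiE_mem[of z "{..<Suc n}" "\<lambda>_. {0..1}" i] by (simp add: space_PiM space_restrict_space)
  have sp: "{z \<in> space (cube (Suc n)). \<forall>i<Suc n. z i \<le> ?u i} = space (cube (Suc n))"
    using le by auto
  have "(\<Sum>i<Suc n. pseudo_inverse (williamson_generator (Suc n) \<gamma>) (?u i)) = 0"
    by (rule sum.neutral) (simp add: pseudo_inverse_one)
  then have "emeasure (copula_of T) (space (cube (Suc n))) = (\<integral>\<^sup>+t. ennreal (kern 0 t) \<partial>T)"
    using emeasure_copula_of_corner[OF T u] unfolding sp by simp
  also have "\<dots> = emeasure T (space T)" by (simp add: kern_def)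
  finally show ?thesis .
qed

lemma finite_copula_of: "dominated T \<Longrightarrow> finite_measure (copula_of T)"
  using emeasure_copula_of_space[of T] finite_measure.emeasure_finite[OF dominated_finite[of T]]
  by (intro finite_measureI) (simp add: copula_of_def)

lemma has_cdf_copula_of:
  assumes C: "\<And>x. x \<in> space (cube (Suc n)) \<Longrightarrow> C x = archimedean (Suc n) (williamson_generator (Suc n) \<gamma>) x"
  shows "has_cdf (Suc n) (copula_of \<gamma>) C"
  unfolding has_cdf_def
proof (intro conjI ballI)
  show "prob_space (copula_of \<gamma>)"
    using emeasure_copula_of_space[OF dominated_self] emeasure_space_1
    by (intro prob_spaceI) (simp add: copula_of_def)
  show "sets (copula_of \<gamma>) = sets (cube (Suc n))" by (simp add: copula_of_def)
  fix u assume u: "u \<in> space (cube (Suc n))"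
  let ?a = "\<Sum>i<Suc n. pseudo_inverse (williamson_generator (Suc n) \<gamma>) (u i)"
  have "(\<integral>\<^sup>+t. ennreal (kern (enn2real ?a) t) \<partial>\<gamma>) = ennreal (psi (enn2real ?a))"
    unfolding psi_def
    by (rule nn_integral_eq_integral) (auto simp: space_gamma kern_bounds)
  then have "emeasure (copula_of \<gamma>) {z \<in> space (cube (Suc n)). \<forall>i<Suc n. z i \<le> u i} =
      ennreal (if ?a = \<infinity> then 0 else psi (enn2real ?a))"
    unfolding emeasure_copula_of_corner[OF dominated_self u] by (cases "?a = \<infinity>") (simp_all only: if_True if_False nn_integral_const mult_zero_left ennreal_0 refl)
  then show "measure (copula_of \<gamma>) {z \<in> space (cube (Suc n)). \<forall>i<Suc n. z i \<le> u i} = C u"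
    unfolding C[OF u] archimedean_def ext_gen_eq measure_def
    by (simp only: enn2real_ennreal psi_nonneg split: if_split) simp
qed

lemma emeasure_marginal:
  assumes E: "E \<in> sets (cube n)"
  shows "emeasure marginal E = emeasure (copula_of \<gamma>) {z \<in> space (cube (Suc n)). restrict z {..<n} \<in> E \<and> z n \<in> {0..1}}"
proof -
  have "emeasure marginal E = (\<integral>\<^sup>+y. indicator E y \<partial>marginal)"
    using E by (subst nn_integral_indicator) (auto simp: marginal_def)
  also have "\<dots> = (\<integral>\<^sup>+x. (if nonneg_vec x then total_dens (\<Sum>i<n. x i) else 0) * indicator E (psi_vec x) \<partial>leb)"
    by (rule nn_integral_marginal) (rule borel_measurable_indicator[OF E])
  also have "\<dots> = emeasure (copula_of \<gamma>) {z \<in> space (cube (Suc n)). restrict z {..<n} \<in> E \<and> z n \<in> {0..1}}"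
  proof -
    have "indicator {0..1} (psi z) = (1 :: ennreal)" for z
      using psi_unit by (simp only: indicator_simps(1))
    then show ?thesis
      by (subst emeasure_copula_of_rect[OF dominated_self E]) (simp_all add: sets_restrict_space_iff total_dens_def cong: if_cong)
  qed
  finally show ?thesis .
qed

text \<open>Setting the last argument to \<open>1\<close> leaves that coordinate free, so the
  projection of \<open>copula_of \<gamma>\<close>, which is \<open>marginal\<close>, has the
  required distribution function.\<close>

lemma has_cdf_marginal:
  assumes cdf: "has_cdf (Suc n) (copula_of \<gamma>) C"
  shows "has_cdf n marginal (marginal_copula (Suc n) C)"
  unfolding has_cdf_def
proof (intro conjI ballI)
  have unit: "z i \<in> {0..1}" if "z \<in> space (cube m)" "i < m" for z i m
    using that PiE_mem[of z "{..<m}" "\<lambda>_. {0..1}" i] by (simp add: space_PiM space_restrict_space)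
  have res: "restrict z {..<n} \<in> space (cube n)" if "z \<in> space (cube (Suc n))" for z
    using that by (auto simp: space_PiM space_restrict_space PiE_iff)
  have "{z \<in> space (cube (Suc n)). restrict z {..<n} \<in> space (cube n) \<and> z n \<in> {0..1}} = space (cube (Suc n))"
    using res unit[of _ "Suc n" n] by blast
  then have "emeasure marginal (space (cube n)) = 1"
    using emeasure_marginal[of "space (cube n)"] emeasure_copula_of_space[OF dominated_self] emeasure_space_1
    by simp
  then show "prob_space marginal"
    by (intro prob_spaceI) (simp add: marginal_def)
  show "sets marginal = sets (cube n)" by (simp add: marginal_def)
  fix u assume u: "u \<in> space (cube n)"
  let ?B = "{x \<in> space (cube n). \<forall>i<n. x i \<le> u i}"
  have B: "?B \<in> sets (cube n)" by (rule corner_in_sets_cube)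
  have u': "u(n := 1) \<in> space (cube (Suc n))"
    using u by (auto simp: space_PiM space_restrict_space PiE_iff extensional_def less_Suc_eq)
  have eq: "{z \<in> space (cube (Suc n)). restrict z {..<n} \<in> ?B \<and> z n \<in> {0..1}} =
      {z \<in> space (cube (Suc n)). \<forall>i<Suc n. z i \<le> (u(n := 1)) i}"
  proof (intro Collect_cong conj_cong refl)
    fix z assume z: "z \<in> space (cube (Suc n))"
    then have "z n \<in> {0..1}" "restrict z {..<n} \<in> space (cube n)" using unit[OF z, of n] res[OF z] by simp_all
    then show "(restrict z {..<n} \<in> ?B \<and> z n \<in> {0..1}) \<longleftrightarrow> (\<forall>i<Suc n. z i \<le> (u(n := 1)) i)"
      by (auto simp: less_Suc_eq)
  qed
  have "measure marginal ?B = measure (copula_of \<gamma>) {z \<in> space (cube (Suc n)). \<forall>i<Suc n. z i \<le> (u(n := 1)) i}"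
    using emeasure_marginal[OF B] unfolding measure_def eq by simp
  also have "\<dots> = C (u(n := 1))"
    using cdf u' unfolding has_cdf_def by blast
  also have "\<dots> = marginal_copula (Suc n) C u"
    by (simp add: marginal_copula_def)
  finally show "measure marginal ?B = marginal_copula (Suc n) C u" .
qed

section \<open>Decomposition of the conditional distribution\<close>

lemma sets_kernel: "sets (kernel T s) = sets unit_interval"
  by (simp add: kernel_def)

lemma space_kernel: "space (kernel T s) = {0..1}"
  by (simp add: kernel_def space_restrict_space)

text \<open>On positive values the map is the inverse of \<open>t \<mapsto> psi (1 / t - s)\<close>.
  It is locally Lipschitz because \<open>psi_inv\<close> is, and because its denominators are at
  least \<open>s\<close>.\<close>

lemma negligible_image_inverse:
  assumes "0 < s" "negligible B"
  shows "negligible ((\<lambda>b. 1 / (s + psi_inv b)) ` (B \<inter> {0<..1}))"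
proof (rule negligible_locally_Lipschitz_image)
  show "negligible (B \<inter> {0<..1})" using assms(2) by (rule negligible_Int[OF disjI1])
  have pos: "0 \<le> psi_inv b" if b: "0 < b" "b \<le> 1" for b
  proof -
    obtain z where "0 \<le> z" "psi z = b" using psi_surj[OF b] by blast
    then show ?thesis using psi_inv_psi[of z] b by simp
  qed
  fix b assume "b \<in> B \<inter> {0<..1}"
  then have b: "0 < b" "b \<le> 1" by auto
  obtain T L where T: "open T" "b \<in> T"
    and L: "\<And>b'. b' \<in> T \<Longrightarrow> 0 < b' \<Longrightarrow> b' \<le> 1 \<Longrightarrow> \<bar>psi_inv b' - psi_inv b\<bar> \<le> L * \<bar>b' - b\<bar>"
    using psi_inv_locally_Lipschitz[OF b] by metis
  have "norm (1 / (s + psi_inv b') - 1 / (s + psi_inv b)) \<le> (L / s\<^sup>2) * norm (b' - b)"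
    if "b' \<in> B \<inter> {0<..1} \<inter> T" for b'
  proof -
    have b': "0 < b'" "b' \<le> 1" "b' \<in> T" using that by auto
    note p = pos[OF b] pos[OF b'(1,2)]
    have s2: "s\<^sup>2 \<le> (s + psi_inv b') * (s + psi_inv b)"
      unfolding power2_eq_square using p assms(1) by (intro mult_mono) auto
    have "1 / (s + psi_inv b') - 1 / (s + psi_inv b) = (psi_inv b - psi_inv b') / ((s + psi_inv b') * (s + psi_inv b))"
      using p assms(1) by (simp add: diff_frac_eq)
    then have "norm (1 / (s + psi_inv b') - 1 / (s + psi_inv b)) =
        \<bar>psi_inv b' - psi_inv b\<bar> / ((s + psi_inv b') * (s + psi_inv b))"
      using p assms(1) by (simp add: abs_mult abs_minus_commute)
    also have "\<dots> \<le> \<bar>psi_inv b' - psi_inv b\<bar> / s\<^sup>2"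
      using s2 assms(1) p by (intro divide_left_mono mult_pos_pos) auto
    also have "\<dots> \<le> (L * \<bar>b' - b\<bar>) / s\<^sup>2"
      using L[OF b'(3,1,2)] assms(1) by (intro divide_right_mono) auto
    finally show ?thesis by simp
  qed
  with T show "\<exists>T B'. open T \<and> b \<in> T \<and> (\<forall>b'\<in>B \<inter> {0<..1} \<inter> T.
      norm (1 / (s + psi_inv b') - 1 / (s + psi_inv b)) \<le> B' * norm (b' - b))"
    by blast
qed simp

lemma negligible_image_forward:
  assumes "0 < s" "negligible N"
  shows "negligible ((\<lambda>t. psi (1 / t - s)) ` (N \<inter> {t. 0 < t \<and> t * s < 1}))"
proof (rule negligible_locally_Lipschitz_image)
  show "negligible (N \<inter> {t. 0 < t \<and> t * s < 1})" using assms(2) by (rule negligible_Int[OF disjI1])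
  fix t assume "t \<in> N \<inter> {t. 0 < t \<and> t * s < 1}"
  then have t: "0 < t" "t * s < 1" by auto
  define z where "z = 1 / t - s"
  have z: "0 < z" using t by (simp add: z_def field_simps)
  \<comment> \<open>For \<open>t'\<close> in this interval the right end gives
    \<open>z / 2 < 1 / t' - s\<close>, as the Lipschitz bound for \<open>psi\<close> requires; the
    left end bounds \<open>1 / (t' * t)\<close> in the difference of the reciprocals.\<close>
  let ?T = "{t / 2<..<1 / (z / 2 + s)}"
  have "1 / t = z + s" by (simp add: z_def)
  then have "z / 2 + s < 1 / t" using z by simp
  then have "t < 1 / (z / 2 + s)" using t z assms(1) by (simp add: field_simps)
  then have T: "open ?T" "t \<in> ?T" using t by auto
  have "norm (psi (1 / t' - s) - psi (1 / t - s)) \<le> (2 / z * (2 / t\<^sup>2)) * norm (t' - t)"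
    if "t' \<in> ?T" for t'
  proof -
    have t': "t / 2 < t'" "t' < 1 / (z / 2 + s)" using that by auto
    then have pos: "0 < t'" using t by linarith
    have "z / 2 + s < 1 / t'" using t' pos z assms(1) by (simp add: field_simps)
    then have 1: "\<bar>psi (1 / t' - s) - psi z\<bar> \<le> 2 / z * \<bar>(1 / t' - s) - z\<bar>"
      using z by (intro psi_locally_Lipschitz) auto
    have "(1 / t' - s) - z = (t - t') / (t' * t)"
      using pos t by (simp add: z_def diff_frac_eq)
    then have "\<bar>(1 / t' - s) - z\<bar> = \<bar>t' - t\<bar> / (t' * t)"
      using pos t by (simp add: abs_mult abs_minus_commute)
    also have "\<dots> \<le> \<bar>t' - t\<bar> / (t / 2 * t)"
      using t t' pos by (intro divide_left_mono mult_right_mono) auto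
    also have "\<dots> = 2 / t\<^sup>2 * \<bar>t' - t\<bar>" using t by (simp add: power2_eq_square)
    finally have "2 / z * \<bar>(1 / t' - s) - z\<bar> \<le> 2 / z * (2 / t\<^sup>2 * \<bar>t' - t\<bar>)"
      using z by (intro mult_left_mono) auto
    with 1 show ?thesis unfolding z_def real_norm_def mult.assoc by (rule order_trans)
  qed
  with T show "\<exists>T B. open T \<and> t \<in> T \<and> (\<forall>t'\<in>N \<inter> {t. 0 < t \<and> t * s < 1} \<inter> T.
      norm (psi (1 / t' - s) - psi (1 / t - s)) \<le> B * norm (t' - t))"
    by blast
qed simp

lemma emeasure_kernel_zero:
  assumes T: "dominated T" and F: "F \<in> sets unit_interval"
    and W: "{t \<in> space T. 0 < t \<and> t * s < 1 \<and> psi (1 / t - s) \<in> F} \<subseteq> W" "W \<in> null_sets T"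
  shows "emeasure (kernel T s) F = 0"
proof -
  have "AE t in T. \<not> (0 < t \<and> t * s < 1 \<and> psi (1 / t - s) \<in> F)"
    by (rule AE_I'[OF W(2)]) (use W(1) in auto)
  with dominated_AE[OF T] have "AE t in T. dens s t / total_dens s * indicator F (psi (1 / t - s)) = 0"
    by eventually_elim (auto simp: dens_def indicator_def)
  then have "(\<integral>\<^sup>+t. dens s t / total_dens s * indicator F (psi (1 / t - s)) \<partial>T) = (\<integral>\<^sup>+t. 0 \<partial>T)"
    by (rule nn_integral_cong_AE)
  then show ?thesis using emeasure_kernel[OF T F] by simp
qed

lemma psi_zero_null_dominated:
  assumes "dominated T" "0 < s"
  shows "{t \<in> space T. 0 < t \<and> t * s \<le> 1 \<and> psi (1 / t - s) = 0} \<in> null_sets T"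
  using dominated_null[OF assms(1) psi_zero_null[OF assms(2)]]
  by (simp add: dominated_space[OF assms(1)] space_gamma)

lemma kernel_point:
  assumes "0 < t" "t * s < 1" "0 < psi (1 / t - s)"
  shows "t = 1 / (s + psi_inv (psi (1 / t - s)))"
proof -
  have "s \<le> 1 / t" using assms by (simp add: field_simps)
  then have "psi_inv (psi (1 / t - s)) = 1 / t - s" using assms by (intro psi_inv_psi) auto
  then show ?thesis using assms by simp
qed

text \<open>The relevant preimage of a null set \<open>B\<close> is covered by the image of the
  positive part of \<open>B\<close> under the locally Lipschitz inverse, which is Lebesgue null, and
  by the preimage of \<open>0\<close>, which is null by \<open>psi_zero_null\<close>.\<close>

lemma abs_cont_kernel:
  assumes T: "dominated T" and s: "0 < s" and ac: "abs_cont T"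
  shows "abs_cont (kernel T s)"
proof (subst abs_cont_iff[of "{0..1}"], simp, simp add: sets_kernel, intro ballI impI)
  note dominated_measurable[OF T, measurable (raw)]
  fix B assume "B \<in> sets (kernel T s)" and null: "B \<in> null_sets lborel"
  then have B: "B \<in> sets unit_interval" by (simp add: sets_kernel)
  note [measurable] = unit_interval_borel[OF B]
  have sT: "sets T = sets (restrict_space borel {0..})"
    using dominated_sets[OF T] sets_gamma by simp
  let ?W = "{t. 0 < t \<and> t * s < 1 \<and> 0 < psi (1 / t - s) \<and> psi (1 / t - s) \<in> B}"
  have W: "?W \<in> sets borel" by measurable
  have "negligible B"
    using null by (simp add: negligible_iff_null_sets null_sets_completionI)
  then have "negligible ((\<lambda>b. 1 / (s + psi_inv b)) ` (B \<inter> {0<..1}))"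
    by (rule negligible_image_inverse[OF s])
  moreover have "?W \<subseteq> (\<lambda>b. 1 / (s + psi_inv b)) ` (B \<inter> {0<..1})"
  proof
    fix t assume "t \<in> ?W"
    then have t: "0 < t" "t * s < 1" "0 < psi (1 / t - s)" "psi (1 / t - s) \<in> B" by auto
    show "t \<in> (\<lambda>b. 1 / (s + psi_inv b)) ` (B \<inter> {0<..1})"
      using t psi_le_one kernel_point[OF t(1-3)] by (intro image_eqI[where x="psi (1 / t - s)"]) auto
  qed
  ultimately have "negligible ?W" by (rule negligible_subset)
  then have Wnull: "?W \<in> null_sets lborel"
    using W by (simp add: negligible_iff_null_sets null_sets_completion_iff)
  have "?W \<in> sets T" using W by (auto simp: sT sets_restrict_space_iff)
  then have "?W \<in> null_sets T"
    using ac Wnull abs_cont_iff[of "{0..}" T] sT by auto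
  with psi_zero_null_dominated[OF T s]
  have "{t \<in> space T. 0 < t \<and> t * s \<le> 1 \<and> psi (1 / t - s) = 0} \<union> ?W \<in> null_sets T"
    by (rule null_sets.Un)
  then show "emeasure (kernel T s) B = 0"
    by (rule emeasure_kernel_zero[OF T B, rotated])
       (use psi_nonneg in \<open>auto simp: order_le_less\<close>)
qed

lemma discrete_kernel:
  assumes T: "dominated T" and s: "0 < s" and dis: "discrete_measure T"
  shows "discrete_measure (kernel T s)"
proof -
  obtain c where c: "c \<in> sets T" "countable c" "emeasure T (space T - c) = 0"
    using dis by (auto simp: discrete_measure_def)
  define A where "A = (\<lambda>t. psi (1 / t - s)) ` c"
  have A: "countable A" "A \<subseteq> {0..1}" using c psi_unit by (auto simp: A_def)
  then have sA: "A \<in> sets unit_interval"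
    by (simp add: sets_restrict_space_iff borel_closed countable_imp_null_set_lborel null_setsD2[of A lborel, simplified])
  then have "{0..1} - A \<in> sets unit_interval"
    using sets.compl_sets[OF sA] by (simp add: space_restrict_space)
  then have "emeasure (kernel T s) ({0..1} - A) = 0"
    by (rule emeasure_kernel_zero[OF T, where W="space T - c"]) (use c in \<open>auto simp: A_def\<close>)
  then show ?thesis
    unfolding discrete_measure_def using A sA by (intro bexI[of _ A]) (auto simp: sets_kernel space_kernel)
qed

text \<open>A value \<open>x > 0\<close> has at most one preimage and \<open>0\<close> has a null
  set of them, so no atoms arise. The locally Lipschitz forward map sends the null set carrying
  \<open>T\<close> to a null set carrying the kernel.\<close>

lemma singular_kernel:
  assumes T: "dominated T" and s: "0 < s" and sing: "singular_measure T"
  shows "singular_measure (kernel T s)"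
  unfolding singular_measure_def
proof (intro conjI ballI)
  fix x assume "x \<in> space (kernel T s)"
  then have x: "0 \<le> x" "x \<le> 1" by (auto simp: space_kernel)
  have F: "{x} \<in> sets unit_interval" using x by (simp add: sets_restrict_space_iff)
  show "emeasure (kernel T s) {x} = 0"
  proof (cases "x = 0")
    case True
    show ?thesis
      by (rule emeasure_kernel_zero[OF T F _ psi_zero_null_dominated[OF T s]]) (use True in auto)
  next
    case False
    let ?t = "1 / (s + psi_inv x)"
    have sub: "{t \<in> space T. 0 < t \<and> t * s < 1 \<and> psi (1 / t - s) \<in> {x}} \<subseteq> {?t} \<inter> space T"
      using kernel_point[of _ s] x False by auto
    have "{?t} \<inter> space T \<in> null_sets T"
    proof (cases "?t \<in> space T")
      case True
      then have "{?t} \<in> sets T"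
        using dominated_sets[OF T] dominated_space[OF T] by (simp add: sets_gamma sets_restrict_space_iff)
      then show ?thesis using sing True by (auto simp: singular_measure_def null_sets_def)
    qed simp
    then show ?thesis by (rule emeasure_kernel_zero[OF T F sub])
  qed
next
  obtain N where N: "N \<in> sets T" "N \<in> null_sets lborel" "emeasure T (space T - N) = 0"
    using sing by (auto simp: singular_measure_def)
  let ?g = "\<lambda>t. psi (1 / t - s)"
  have "negligible N"
    using N by (simp add: negligible_iff_null_sets null_sets_completionI)
  then have "negligible (?g ` (N \<inter> {t. 0 < t \<and> t * s < 1}))"
    by (rule negligible_image_forward[OF s])
  \<comment> \<open>The image of a Borel set need not be Borel, hence the passage to a Borel null
    set \<open>N'\<close> around it.\<close>
  then obtain N' where N': "N' \<in> null_sets lborel" "?g ` (N \<inter> {t. 0 < t \<and> t * s < 1}) \<subseteq> N'"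
    unfolding negligible_iff_null_sets null_sets_completion_iff2 by auto
  let ?A = "N' \<inter> {0..1}"
  have A: "?A \<in> sets unit_interval"
    using N' by (auto simp: sets_restrict_space_iff)
  then have "{0..1} - ?A \<in> sets unit_interval"
    using sets.compl_sets[OF A] by (simp add: space_restrict_space)
  then have "emeasure (kernel T s) ({0..1} - ?A) = 0"
    by (rule emeasure_kernel_zero[OF T, where W="space T - N"]) (use N N' in auto)
  moreover have "?A \<in> null_sets lborel"
    using N' by (intro null_set_Int2) auto
  ultimately show "\<exists>N\<in>sets (kernel T s). N \<in> null_sets lborel \<and> emeasure (kernel T s) (space (kernel T s) - N) = 0"
    using A by (intro bexI[of _ ?A]) (auto simp: sets_kernel space_kernel)
qed

section \<open>From the parts of the Williamson measure to the components of the copula\<close>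

lemma dominated_density_indicator:
  "P \<in> sets \<gamma> \<Longrightarrow> dominated (density \<gamma> (indicator P))"
  by (auto simp: dominated_def emeasure_restricted intro!: emeasure_mono)

lemma decomposition_kernel:
  assumes PQR: "P \<in> sets \<gamma>" "Q \<in> sets \<gamma>" "R \<in> sets \<gamma>"
    and part: "\<And>x. x \<in> space \<gamma> \<Longrightarrow> indicator P x + indicator Q x + indicator R x = (1 :: ennreal)"
    and L: "lebesgue_decomposition \<gamma> (density \<gamma> (indicator P)) (density \<gamma> (indicator Q)) (density \<gamma> (indicator R))"
    and s: "0 < s"
  shows "lebesgue_decomposition (kernel \<gamma> s) (kernel (density \<gamma> (indicator P)) s)
    (kernel (density \<gamma> (indicator Q)) s) (kernel (density \<gamma> (indicator R)) s)"
proof -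
  note dom = PQR[THEN dominated_density_indicator]
  have ac: "abs_cont (density \<gamma> (indicator P))" and dis: "discrete_measure (density \<gamma> (indicator Q))"
    and sing: "singular_measure (density \<gamma> (indicator R))"
    using L by (auto simp: lebesgue_decomposition_def)
  have sum: "emeasure (kernel \<gamma> s) F = emeasure (kernel (density \<gamma> (indicator P)) s) F
    + emeasure (kernel (density \<gamma> (indicator Q)) s) F + emeasure (kernel (density \<gamma> (indicator R)) s) F"
    if F: "F \<in> sets unit_interval" for F
  proof -
    note measurable_id_gamma[measurable (raw)]
    note [measurable] = unit_interval_borel[OF F]
    have "(\<lambda>t. dens s t / total_dens s * indicator F (psi (1 / t - s))) \<in> borel_measurable \<gamma>" by measurable
    from nn_integral_indicator_partition[OF PQR part this] show ?thesis
      using emeasure_kernel[OF _ F] dom dominated_self by simp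
  qed
  show ?thesis
    unfolding lebesgue_decomposition_def
    using abs_cont_kernel[OF dom(1) s ac] discrete_kernel[OF dom(2) s dis] singular_kernel[OF dom(3) s sing] sum
    by (simp add: sets_kernel)
qed

text \<open>The part of \<open>K y\<close> is known only almost everywhere; this suffices, because a
  disintegration sees it only through integrals against the marginal.\<close>

lemma copula_component_eq:
  assumes C: "\<And>x. x \<in> space (cube (Suc n)) \<Longrightarrow> C x = archimedean (Suc n) (williamson_generator (Suc n) \<gamma>) x"
    and T: "dominated T"
    and eq: "AE y in marginal. \<pi> (K y) = kernel T (psi_inv_sum y)"
  shows "emeasure (copula_component \<pi> (Suc n) C K) (space (cube (Suc n))) = emeasure T (space T)"
proof -
  have marg: "marginal_measure (Suc n) C = marginal"
    using copula_measure_eqI[OF has_cdf_marginal[OF has_cdf_copula_of[OF C]]] by simp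
  have "(\<integral>\<^sup>+y\<in>E. emeasure (\<pi> (K y)) F \<partial>marginal) = (\<integral>\<^sup>+y\<in>E. emeasure (kernel T (psi_inv_sum y)) F \<partial>marginal)" for E F
    by (rule nn_integral_cong_AE) (use eq in \<open>eventually_elim, simp\<close>)
  then have dis: "disintegrates (Suc n) (copula_of T) marginal (\<lambda>y. \<pi> (K y))"
    using disintegrates_copula_of[OF T] by (simp add: disintegrates_def)
  have "copula_component \<pi> (Suc n) C K = copula_of T"
    unfolding copula_component_def marg
    by (rule the_equality[where P="\<lambda>M. disintegrates (Suc n) M marginal (\<lambda>y. \<pi> (K y))", OF dis])
       (rule disintegrates_unique[OF dis _ finite_copula_of[OF T], symmetric])
  then show ?thesis using emeasure_copula_of_space[OF T] by simp
qed

text \<open>Both kernels disintegrate the same copula measure over the same marginal, so an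
  arbitrary version may be replaced by the explicit one.\<close>

lemma conditional_distribution_eq_kernel:
  assumes C: "\<And>x. x \<in> space (cube (Suc n)) \<Longrightarrow> C x = archimedean (Suc n) (williamson_generator (Suc n) \<gamma>) x"
    and K: "regular_conditional_distribution (Suc n) C K"
  shows "AE y in marginal. K y = kernel \<gamma> (psi_inv_sum y)"
proof (rule kernel_AE_unique)
  have cop: "copula_measure (Suc n) C = copula_of \<gamma>"
    by (rule copula_measure_eqI[OF has_cdf_copula_of[OF C]])
  have cdf: "has_cdf n marginal (marginal_copula (Suc n) C)"
    by (rule has_cdf_marginal[OF has_cdf_copula_of[OF C]])
  have marg: "marginal_measure (Suc n) C = marginal"
    using copula_measure_eqI[OF cdf] by simp
  show "finite_measure marginal" "sets marginal = sets (cube n)"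
    using cdf by (auto simp: has_cdf_def prob_space_def)
  show "K \<in> measurable (cube n) (prob_algebra unit_interval)"
    using K by (simp add: regular_conditional_distribution_def)
  have dis: "disintegrates (Suc n) (copula_of \<gamma>) marginal K"
    using K unfolding regular_conditional_distribution_def cop marg by blast
  show "(\<integral>\<^sup>+y\<in>E. emeasure (K y) F \<partial>marginal) = (\<integral>\<^sup>+y\<in>E. emeasure (kernel \<gamma> (psi_inv_sum y)) F \<partial>marginal)"
    if "E \<in> sets (cube n)" "F \<in> sets unit_interval" for E F
  proof -
    let ?Z = "{z \<in> space (cube (Suc n)). restrict z {..<n} \<in> E \<and> z n \<in> F}"
    have "emeasure (copula_of \<gamma>) ?Z = (\<integral>\<^sup>+y\<in>E. emeasure (K y) F \<partial>marginal)"
      using dis that unfolding disintegrates_def diff_Suc_1 by blast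
    moreover have "emeasure (copula_of \<gamma>) ?Z = (\<integral>\<^sup>+y\<in>E. emeasure (kernel \<gamma> (psi_inv_sum y)) F \<partial>marginal)"
      using disintegrates_copula_of[OF dominated_self] that unfolding disintegrates_def diff_Suc_1 by blast
    ultimately show ?thesis by (rule trans[OF sym])
  qed
  show "(\<lambda>y. emeasure (kernel \<gamma> (psi_inv_sum y)) F) \<in> borel_measurable (cube n)"
    if "F \<in> sets unit_interval" for F
    by (rule measurable_compose[OF psi_inv_sum_measurable emeasure_kernel_measurable[OF dominated_self that]])
qed (rule sets_kernel)

text \<open>Uniqueness of the Lebesgue decomposition turns the parts of almost every
  \<open>K y\<close> into kernels of the parts of \<open>\<gamma>\<close>. Each component thus has
  the mass of one part, and that mass decides the type of \<open>\<gamma>\<close> by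
  \<open>decomposition_mass\<close>.\<close>

lemma components_characterization:
  assumes C: "\<And>x. x \<in> space (cube (Suc n)) \<Longrightarrow> C x = archimedean (Suc n) (williamson_generator (Suc n) \<gamma>) x"
    and K: "regular_conditional_distribution (Suc n) C K"
  shows "abs_cont \<gamma> \<longleftrightarrow> emeasure (copula_component abs_part (Suc n) C K) (space (cube (Suc n))) = 1"
    "discrete_measure \<gamma> \<longleftrightarrow> emeasure (copula_component dis_part (Suc n) C K) (space (cube (Suc n))) = 1"
    "singular_measure \<gamma> \<longleftrightarrow> emeasure (copula_component sing_part (Suc n) C K) (space (cube (Suc n))) = 1"
proof -
  have half: "{0::real..} \<in> sets borel" by simp
  obtain P Q R where PQR: "P \<in> sets \<gamma>" "Q \<in> sets \<gamma>" "R \<in> sets \<gamma>"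
    and part: "\<And>x. x \<in> space \<gamma> \<Longrightarrow> indicator P x + indicator Q x + indicator R x = (1 :: ennreal)"
    and L: "lebesgue_decomposition \<gamma> (density \<gamma> (indicator P)) (density \<gamma> (indicator Q)) (density \<gamma> (indicator R))"
    using lebesgue_decomposition_exists[OF finite_measure_axioms half sets_gamma] by metis
  note AE_psi_inv_sum_pos
  moreover have "AE y in marginal. K y = kernel \<gamma> (psi_inv_sum y)"
    by (rule conditional_distribution_eq_kernel[OF C K])
  ultimately have "AE y in marginal. lebesgue_decomposition (K y) (kernel (density \<gamma> (indicator P)) (psi_inv_sum y))
    (kernel (density \<gamma> (indicator Q)) (psi_inv_sum y)) (kernel (density \<gamma> (indicator R)) (psi_inv_sum y))
    \<and> sets (K y) = sets unit_interval"
    by eventually_elim (simp add: decomposition_kernel[OF PQR part L] sets_kernel)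
  then have eq: "AE y in marginal. abs_part (K y) = kernel (density \<gamma> (indicator P)) (psi_inv_sum y)"
    "AE y in marginal. dis_part (K y) = kernel (density \<gamma> (indicator Q)) (psi_inv_sum y)"
    "AE y in marginal. sing_part (K y) = kernel (density \<gamma> (indicator R)) (psi_inv_sum y)"
    by (eventually_elim, use parts_eq[of "{0..1}"] in auto)+
  note dom = PQR[THEN dominated_density_indicator]
  note mass = decomposition_mass[OF prob_space_axioms half sets_gamma L]
  show "abs_cont \<gamma> \<longleftrightarrow> emeasure (copula_component abs_part (Suc n) C K) (space (cube (Suc n))) = 1"
    unfolding mass(1) using copula_component_eq[where \<pi>=abs_part and K=K, OF C dom(1) eq(1)] by simp
  show "discrete_measure \<gamma> \<longleftrightarrow> emeasure (copula_component dis_part (Suc n) C K) (space (cube (Suc n))) = 1"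
    unfolding mass(2) using copula_component_eq[where \<pi>=dis_part and K=K, OF C dom(2) eq(2)] by simp
  show "singular_measure \<gamma> \<longleftrightarrow> emeasure (copula_component sing_part (Suc n) C K) (space (cube (Suc n))) = 1"
    unfolding mass(3) using copula_component_eq[where \<pi>=sing_part and K=K, OF C dom(3) eq(3)] by simp
qed

end

theorem corollary3p13:
  fixes d :: nat
    and C :: "(nat \<Rightarrow> real) \<Rightarrow> real"
    and \<gamma> :: "real measure"
    and K :: "(nat \<Rightarrow> real) \<Rightarrow> real measure"
  assumes "d \<ge> 2"
    and "archimedean_copula d C"
    and "is_williamson_measure_of d \<gamma> C"
    and "regular_conditional_distribution d C K"
  shows "(abs_cont \<gamma> \<longleftrightarrow> emeasure (copula_component abs_part d C K) (space (cube d)) = 1) \<and>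
         (discrete_measure \<gamma> \<longleftrightarrow> emeasure (copula_component dis_part d C K) (space (cube d)) = 1) \<and>
         (singular_measure \<gamma> \<longleftrightarrow> emeasure (copula_component sing_part d C K) (space (cube d)) = 1)"
proof -
  obtain n where d: "d = Suc n" "n > 0"
    using assms(1) by (cases d) auto
  have \<gamma>: "prob_space \<gamma>" "sets \<gamma> = sets (restrict_space borel {0..})" "measure \<gamma> {0} = 0"
    and C: "\<And>x. x \<in> space (cube (Suc n)) \<Longrightarrow> C x = archimedean (Suc n) (williamson_generator (Suc n) \<gamma>) x"
    using assms(3) unfolding is_williamson_measure_of_def williamson_measures_def d(1) by blast+
  interpret prob_space \<gamma> by (rule \<gamma>(1))
  interpret williamson_measure \<gamma> n
    by unfold_locales (use d \<gamma> in \<open>auto simp: emeasure_eq_measure\<close>)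
  show ?thesis
    using components_characterization[OF C assms(4)[unfolded d(1)]] unfolding d(1) by blast
qed

end
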